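(* For every real $\delta>0$ there exists $t_0$ such that for all positive integers $t$ and all real numbers $p$ with $t>t_0$ and $0<p\leq \frac{2}{\sqrt{4t+9}-1}$, and for all positive integers $n$, the following holds. If $\mathcal G\subset 2^{[n]}$ is a $3$-wise $t$-intersecting family with $\mu_p(\mathcal G)\geq\left(\frac12+\delta\right)p^t$, then $\mathcal G\subset\mathcal F$ for some family $\mathcal F\subset 2^{[n]}$ such that $\mathcal F\cong\mathcal F_0^t$ or $\mathcal F\cong\mathcal F_1^t$.
   Context: Let $[n]:=\{1,2,\ldots,n\}$ and let $2^{[n]}$ be its power set. $A\subset B$ means that $A$ is a subset of $B$, possibly $A=B$. A family $\mathcal G\subset 2^{[n]}$ is $3$-wise $t$-intersecting if $|G_1\cap G_2\cap G_3|\geq t$ for all (not necessarily distinct) $G_1,G_2,G_3\in\mathcal G$. For $0<p<1$, the $p$-biased measure of $\mathcal G\subset 2^{[n]}$ is $\mu_p(\mathcal G):=\sum_{G\in\mathcal G}p^{|G|}(1-p)^{n-|G|}$. For integers $0\leq i\leq\lfloor\frac{n-t}{3}\rfloor$ define $\mathcal F_i^t:=\{F\subset[n]:|F\cap[t+3i]|\geq t+2i\}$. (In particular $\mathcal F_0^t=\{F\subset[n]:[t]\subset F\}$ and $\mathcal F_1^t=\{F\subset[n]:|F\cap[t+3]|\geq t+2\}$; the family $\mathcal F_i^t$ is defined only when $n\geq t+3i$.) Two families $\mathcal G,\mathcal H\subset 2^{[n]}$ are isomorphic, written $\mathcal G\cong\mathcal H$, if there is a permutation $\tau$ of $[n]$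 such that $\mathcal H=\{\{\tau(x):x\in G\}:G\in\mathcal G\}$. *)

theory Defs
  imports Complex_Main "HOL-Combinatorics.Permutations"
begin

definition three_wise_intersecting :: "nat \<Rightarrow> nat set set \<Rightarrow> bool" where
  "three_wise_intersecting t \<G> \<longleftrightarrow>
     (\<forall>G1\<in>\<G>. \<forall>G2\<in>\<G>. \<forall>G3\<in>\<G>. card (G1 \<inter> G2 \<inter> G3) \<ge> t)"

(* Meant for families of subsets of {1..n}, so that n - card G does not truncate. *)
definition biased_measure :: "nat \<Rightarrow> real \<Rightarrow> nat set set \<Rightarrow> real" where
  "biased_measure n p \<G> = (\<Sum>G\<in>\<G>. p ^ card G * (1 - p) ^ (n - card G))"

(* The family F_i^t on the ground set {1..n}; meaningful only when t + 3 * i \<le> n,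
   a condition that has to be stated wherever the family is used. *)
definition frankl_family :: "nat \<Rightarrow> nat \<Rightarrow> nat \<Rightarrow> nat set set" where
  "frankl_family n t i = {F. F \<subseteq> {1..n} \<and> card (F \<inter> {1..t + 3 * i}) \<ge> t + 2 * i}"

definition isomorphic_families :: "nat \<Rightarrow> nat set set \<Rightarrow> nat set set \<Rightarrow> bool" where
  "isomorphic_families n \<G> \<H> \<longleftrightarrow>
     (\<exists>\<tau>. \<tau> permutes {1..n} \<and> \<H> = (\<lambda>G. \<tau> ` G) ` \<G>)"

end

theory Submission
  imports Defs
begin

text \<open>
  Passing to the up-closure and applying shifts, one may assume that the family is shifted.
  Every member of a shifted 3-wise t-intersecting family lies in some F_j,
  and F_j has measure at most about p^t / j! because t p^2 is at most about 1. If the family is not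
  contained in F_j, then its part in F_j has measure o(p^t). Hence a shifted family contained in
  neither F_0 nor F_1 has measure at most (1/2 + o(1)) p^t if it is contained in F_2, and at most
  (e - 5/2 + o(1)) p^t otherwise.

  Undoing a shift: if the shifted family is contained in a copy of F_0 or F_1 but the original one
  is not, then suitable traces of the original family are cross-intersecting, which again bounds
  its measure by (1/2 + o(1)) p^t. All smallness comes from one inequality: for k pairwise
  cross-intersecting families the p-biased measures sum to at most 1 whenever k p is at most 1.
\<close>

section \<open>The biased measure and cross-intersecting families\<close>

text \<open>For p > 0 the bound on \<open>p\<close> says exactly (t + 2) p^2 <= 1 + p, and in this
  range the measure of F_1 does not exceed that of F_0. The measure of F_2 is about (t p^2)^2 / 2
  times p^t, so the constant 1/2 is the relative size of F_2 at the end of the range.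

  As t grows, \<open>p\<close> is forced to 0, so the threshold on t serves only to make
  \<open>p\<close> small: at most \<open>\<delta> / 10\<close>, so that errors of order
  \<open>p\<close> disappear in \<open>\<delta>\<close>, and at most 2^-18, for the crude union
  bound on the F_j with j >= 3.

  The obstacle is that shifting keeps the measure but forgets which copy of F_0 or F_1 contains the
  family. Shifts are therefore undone one at a time, and at each stage the unchanged measure rules
  out the bad alternative.\<close>

text \<open>Intersecting with \<open>Pow S\<close> allows links and up-sets to be written as plain
  comprehensions such as \<open>{Z. Y \<union> Z \<in> \<G>}\<close>. The exponent
  \<open>card (S - X)\<close> keeps the ground set variable, since points are removed from it in
  inductions and when conditioning on a trace.\<close>

definition pmeas :: "real \<Rightarrow> 'a set \<Rightarrow> 'a set set \<Rightarrow> real" where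
  "pmeas p S A = (\<Sum>X\<in>A \<inter> Pow S. p ^ card X * (1 - p) ^ card (S - X))"

lemma pmeas_nonneg: "0 \<le> p \<Longrightarrow> p \<le> 1 \<Longrightarrow> 0 \<le> pmeas p S A"
  unfolding pmeas_def by (intro sum_nonneg) auto

lemma pmeas_mono:
  assumes "finite S" "0 \<le> p" "p \<le> 1" "A \<inter> Pow S \<subseteq> B"
  shows "pmeas p S A \<le> pmeas p S B"
  unfolding pmeas_def using assms by (intro sum_mono2) auto

lemma pmeas_empty: "A \<inter> Pow S = {} \<Longrightarrow> pmeas p S A = 0"
  by (simp add: pmeas_def)

lemma pmeas_Un_le:
  assumes "finite S" "0 \<le> p" "p \<le> 1"
  shows "pmeas p S (A \<union> B) \<le> pmeas p S A + pmeas p S B"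
proof -
  let ?w = "\<lambda>X. p ^ card X * (1 - p) ^ card (S - X)"
  have "sum ?w (A \<inter> Pow S \<union> B \<inter> Pow S) =
      sum ?w (A \<inter> Pow S) + sum ?w (B \<inter> Pow S) - sum ?w (A \<inter> Pow S \<inter> (B \<inter> Pow S))"
    using assms(1) by (intro sum_Un) auto
  moreover have "0 \<le> sum ?w (A \<inter> Pow S \<inter> (B \<inter> Pow S))"
    using assms by (intro sum_nonneg) auto
  ultimately show ?thesis
    unfolding pmeas_def by (simp add: Int_Un_distrib2)
qed

lemma pmeas_UN_le:
  assumes "finite I" "finite S" "0 \<le> p" "p \<le> 1"
  shows "pmeas p S (\<Union>i\<in>I. A i) \<le> (\<Sum>i\<in>I. pmeas p S (A i))"
  using assms(1)
proof (induction I rule: finite_induct)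
  case empty
  then show ?case by (simp add: pmeas_def)
next
  case (insert i I)
  then show ?case
    using pmeas_Un_le[OF assms(2-4), of "A i" "\<Union>i\<in>I. A i"] by simp
qed

lemma pmeas_UN_le_const:
  assumes "finite I" "finite S" "0 \<le> p" "p \<le> 1" "\<And>i. i \<in> I \<Longrightarrow> pmeas p S (A i) \<le> c"
  shows "pmeas p S (\<Union>i\<in>I. A i) \<le> real (card I) * c"
  using pmeas_UN_le[OF assms(1-4), of A] sum_bounded_above[of I "\<lambda>i. pmeas p S (A i)" c] assms(5)
  by fastforce

section \<open>Conditioning on the trace on a fixed set of points\<close>

lemma pmeas_fiber:
  assumes "finite S" "Y \<subseteq> K" "K \<subseteq> S"
  shows "pmeas p S {G \<in> \<G>. G \<inter> K = Y} =
    p ^ card Y * (1 - p) ^ card (K - Y) * pmeas p (S - K) {Z. Y \<union> Z \<in> \<G>}"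
proof -
  have bij: "bij_betw ((\<union>) Y) ({Z. Y \<union> Z \<in> \<G>} \<inter> Pow (S - K)) ({G \<in> \<G>. G \<inter> K = Y} \<inter> Pow S)"
    by (rule bij_betwI[where g = "\<lambda>G. G - K"]) (use assms in \<open>auto simp: Int_Diff_Un\<close>)
  have "p ^ card (Y \<union> Z) * (1 - p) ^ card (S - (Y \<union> Z)) =
      p ^ card Y * (1 - p) ^ card (K - Y) * (p ^ card Z * (1 - p) ^ card (S - K - Z))"
    if "Z \<subseteq> S - K" for Z
  proof -
    have fin: "finite Y" "finite Z" "finite K"
      using assms that finite_subset by (metis finite_Diff)+
    have "card (Y \<union> Z) = card Y + card Z"
      using fin assms that by (intro card_Un_disjoint) auto
    moreover have "S - (Y \<union> Z) = (K - Y) \<union> (S - K - Z)"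
      using assms that by auto
    moreover have "card ((K - Y) \<union> (S - K - Z)) = card (K - Y) + card (S - K - Z)"
      using fin assms by (intro card_Un_disjoint) auto
    ultimately show ?thesis
      by (simp add: power_add)
  qed
  then show ?thesis
    unfolding pmeas_def sum.reindex_bij_betw[OF bij, symmetric] sum_distrib_left
    by (intro sum.cong) auto
qed

lemma pmeas_insert:
  assumes "finite S" "x \<notin> S"
  shows "pmeas p (insert x S) A = (1 - p) * pmeas p S A + p * pmeas p S {X. insert x X \<in> A}"
proof -
  have eq: "insert x S - {x} = S"
    using assms by auto
  have "pmeas p (insert x S) A =
      pmeas p (insert x S) {G \<in> A. G \<inter> {x} = {}} + pmeas p (insert x S) {G \<in> A. G \<inter> {x} = {x}}"
    unfolding pmeas_def using assms
    by (subst sum.union_disjoint[symmetric]) (auto intro!: sum.cong)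
  then show ?thesis
    using pmeas_fiber[of "insert x S" "{}" "{x}" p A] pmeas_fiber[of "insert x S" "{x}" "{x}" p A] assms
    by (simp add: eq)
qed

lemma pmeas_UNIV: "finite S \<Longrightarrow> pmeas p S UNIV = 1"
proof (induction S rule: finite_induct)
  case empty
  then show ?case by (simp add: pmeas_def)
qed (simp add: pmeas_insert)

lemma pmeas_le_1: "finite S \<Longrightarrow> 0 \<le> p \<Longrightarrow> p \<le> 1 \<Longrightarrow> pmeas p S A \<le> 1"
  using pmeas_mono[of S p A UNIV] by (simp add: pmeas_UNIV)

text \<open>In the applications \<open>K - Y\<close> has only a few points, so bounding the power of
  \<open>1 - p\<close> by 1 loses a factor close to 1.\<close>

lemma pmeas_fiber_le:
  assumes "finite S" "0 \<le> p" "p \<le> 1" "Y \<subseteq> K" "K \<subseteq> S"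
  shows "pmeas p S {G \<in> \<G>. G \<inter> K = Y} \<le> p ^ card Y * pmeas p (S - K) {Z. Y \<union> Z \<in> \<G>}"
proof -
  have "(1 - p) ^ card (K - Y) \<le> 1"
    using assms by (intro power_le_one) auto
  then have "p ^ card Y * (1 - p) ^ card (K - Y) \<le> p ^ card Y * 1"
    using assms by (intro mult_left_mono) auto
  then show ?thesis
    unfolding pmeas_fiber[OF assms(1,4,5)]
    using assms pmeas_nonneg[of p] by (intro mult_right_mono) auto
qed

lemma pmeas_superset_le:
  assumes "finite S" "0 \<le> p" "p \<le> 1"
  shows "pmeas p S {G. E \<subseteq> G} \<le> p ^ card E"
proof (cases "E \<subseteq> S")
  case True
  have "pmeas p S {G \<in> UNIV. G \<inter> E = E} \<le> p ^ card E * pmeas p (S - E) {Z. E \<union> Z \<in> UNIV}"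
    using assms True by (intro pmeas_fiber_le) auto
  then show ?thesis
    using assms by (simp add: pmeas_UNIV Int_absorb1 inf.absorb_iff2)
next
  case False
  then have "pmeas p S {G. E \<subseteq> G} = 0"
    by (intro pmeas_empty) auto
  then show ?thesis
    using assms by simp
qed

(* Colour each point independently with colour i \<in> I with probability p and leave it uncoloured
   otherwise.  The colour classes are disjoint, so at most one class lies in its family. *)
lemma sum_pmeas_cross_intersecting_le_1:
  assumes "finite S" "finite I" "0 \<le> p" "p * real (card I) \<le> 1"
    and "\<And>i j X Y. \<lbrakk>i \<in> I; j \<in> I; i \<noteq> j; X \<in> A i; Y \<in> A j; X \<subseteq> S; Y \<subseteq> S\<rbrakk> \<Longrightarrow> X \<inter> Y \<noteq> {}"
  shows "(\<Sum>i\<in>I. pmeas p S (A i)) \<le> 1"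
  using assms(1,5)
proof (induction S arbitrary: A rule: finite_induct)
  case empty
  have val: "pmeas p {} (A i) = (if {} \<in> A i then 1 else 0)" for i
    by (auto simp: pmeas_def)
  have "card {i \<in> I. {} \<in> A i} \<le> 1"
    using empty assms(2) by (intro card_le_Suc0_iff_eq[THEN iffD2, unfolded One_nat_def[symmetric]]) auto
  then show ?case
    using assms(2) by (simp add: val sum.If_cases Int_def)
next
  case (insert x S)
  let ?a = "\<lambda>i. pmeas p S (A i)" and ?b = "\<lambda>i. pmeas p S {X. insert x X \<in> A i}"
  have zero: "(\<Sum>i\<in>I. ?a i) \<le> 1"
    using insert.prems by (intro insert.IH) blast
  \<comment> \<open>The case in which \<open>x\<close> receives colour \<open>m\<close>: family
    \<open>m\<close> is replaced by its link at \<open>x\<close>, the others by their members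
    avoiding \<open>x\<close>. As no set of another family contains \<open>x\<close> here, the new
    families still cross-intersect.\<close>
  have one: "?b m + ((\<Sum>i\<in>I. ?a i) - ?a m) \<le> 1" if "m \<in> I" for m
  proof -
    let ?A = "A(m := {X. insert x X \<in> A m})"
    have "(\<Sum>i\<in>I. pmeas p S (?A i)) \<le> 1"
    proof (rule insert.IH)
      fix i j X Y assume *: "i \<in> I" "j \<in> I" "i \<noteq> j" "X \<in> ?A i" "Y \<in> ?A j" "X \<subseteq> S" "Y \<subseteq> S"
      then consider "i = m" "j \<noteq> m" | "i \<noteq> m" "j = m" | "i \<noteq> m" "j \<noteq> m" by auto
      then show "X \<inter> Y \<noteq> {}"
      proof cases
        case 1
        then have "insert x X \<inter> Y \<noteq> {}"
          using insert.prems[of i j "insert x X" Y] * by auto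
        then show ?thesis using * insert.hyps by auto
      next
        case 2
        then have "X \<inter> insert x Y \<noteq> {}"
          using insert.prems[of i j X "insert x Y"] * by auto
        then show ?thesis using * insert.hyps by auto
      next
        case 3
        then show ?thesis using insert.prems[of i j X Y] * by auto
      qed
    qed
    then show ?thesis
      using assms(2) that by (simp add: sum.remove[of I m])
  qed
  have "(\<Sum>m\<in>I. ?b m + ((\<Sum>i\<in>I. ?a i) - ?a m)) \<le> real (card I) * 1"
    using one by (intro sum_bounded_above) auto
  then have *: "(\<Sum>m\<in>I. ?b m) + (real (card I) - 1) * (\<Sum>i\<in>I. ?a i) \<le> real (card I)"
    by (simp add: sum.distrib sum_subtractf algebra_simps)
  have "(\<Sum>i\<in>I. pmeas p (insert x S) (A i)) = (1 - p) * (\<Sum>i\<in>I. ?a i) + p * (\<Sum>i\<in>I. ?b i)"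
    using insert.hyps by (simp add: pmeas_insert sum.distrib sum_distrib_left)
  \<comment> \<open>Averaging over the colour of \<open>x\<close>: each colour has probability
    \<open>p\<close>, and the weight of "uncoloured" is nonnegative by the hypothesis on
    \<open>p\<close>.\<close>
  also have "\<dots> = p * ((\<Sum>m\<in>I. ?b m) + (real (card I) - 1) * (\<Sum>i\<in>I. ?a i)) +
      (1 - p * real (card I)) * (\<Sum>i\<in>I. ?a i)"
    by (simp add: algebra_simps)
  also have "\<dots> \<le> p * real (card I) + (1 - p * real (card I)) * 1"
    using * zero assms(3,4) by (intro add_mono mult_left_mono) auto
  finally show ?case by simp
qed

lemma pmeas_cross_intersecting_le_1:
  assumes "finite S" "0 \<le> p" "p \<le> 1/2"
    and "\<And>X Y. \<lbrakk>X \<in> A; Y \<in> B; X \<subseteq> S; Y \<subseteq> S\<rbrakk> \<Longrightarrow> X \<inter> Y \<noteq> {}"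
  shows "pmeas p S A + pmeas p S B \<le> 1"
proof -
  have "(\<Sum>i\<in>{True, False}. pmeas p S (if i then A else B)) \<le> 1"
    using assms(1-3)
  proof (intro sum_pmeas_cross_intersecting_le_1)
    fix i j X Y
    assume "i \<noteq> j" "X \<in> (if i then A else B)" "Y \<in> (if j then A else B)" "X \<subseteq> S" "Y \<subseteq> S"
    then show "X \<inter> Y \<noteq> {}"
      using assms(4)[of X Y] assms(4)[of Y X] by (cases i; cases j) auto
  qed auto
  then show ?thesis by simp
qed

text \<open>An intersecting family is cross-intersecting with copies of itself, and floor(1/p)
  copies are allowed. With the rounding this gives \<open>p / (1 - p)\<close>, which is at most
  \<open>2 * p\<close>.\<close>

lemma pmeas_intersecting_le:
  assumes "finite S" "0 < p" "p \<le> 1/2"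
    and "\<And>X Y. \<lbrakk>X \<in> A; Y \<in> A; X \<subseteq> S; Y \<subseteq> S\<rbrakk> \<Longrightarrow> X \<inter> Y \<noteq> {}"
  shows "pmeas p S A \<le> 2 * p"
proof -
  define k where "k = nat \<lfloor>1 / p\<rfloor>"
  have k: "real k \<le> 1 / p" "1 / p < real k + 1"
    unfolding k_def using assms(2) by auto
  have "(\<Sum>i\<in>{..<k}. pmeas p S A) \<le> 1"
  proof (rule sum_pmeas_cross_intersecting_le_1)
    show "p * real (card {..<k}) \<le> 1"
      using k(1) assms(2) by (simp add: field_simps)
  qed (use assms in auto)
  then have "real k * pmeas p S A \<le> 1"
    by simp
  moreover have "(1 / p - 1) * pmeas p S A \<le> real k * pmeas p S A"
    using k assms pmeas_nonneg[of p S A] by (intro mult_right_mono) auto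
  ultimately have "(1 / p - 1) * pmeas p S A \<le> 1"
    by linarith
  then have "p * ((1 / p - 1) * pmeas p S A) \<le> p * 1"
    using assms(2) by (intro mult_left_mono) auto
  moreover have "p * ((1 / p - 1) * pmeas p S A) = (1 - p) * pmeas p S A"
    using assms(2) by (simp add: field_simps)
  ultimately have "(1 - p) * pmeas p S A \<le> p"
    by simp
  moreover have "1/2 * pmeas p S A \<le> (1 - p) * pmeas p S A"
    using assms pmeas_nonneg[of p S A] by (intro mult_right_mono) auto
  ultimately show ?thesis by linarith
qed

section \<open>Shifting\<close>

definition up_closed :: "'a set \<Rightarrow> 'a set set \<Rightarrow> bool" where
  "up_closed S \<G> \<longleftrightarrow> (\<forall>G\<in>\<G>. \<forall>H. G \<subseteq> H \<and> H \<subseteq> S \<longrightarrow> H \<in> \<G>)"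

lemma up_closedD: "up_closed S \<G> \<Longrightarrow> G \<in> \<G> \<Longrightarrow> G \<subseteq> H \<Longrightarrow> H \<subseteq> S \<Longrightarrow> H \<in> \<G>"
  by (auto simp: up_closed_def)

(* The usual (i,j)-shift: a set containing j but not i is replaced by its image under the
   transposition (i j), unless that image already belongs to the family. *)
definition shift :: "'a \<Rightarrow> 'a \<Rightarrow> 'a set set \<Rightarrow> 'a set set" where
  "shift i j \<G> = {H. H \<in> \<G> \<and> transpose i j ` H \<in> \<G> \<or>
     i \<in> H \<and> j \<notin> H \<and> (H \<in> \<G> \<or> transpose i j ` H \<in> \<G>)}"

lemma mem_transpose_image: "x \<in> transpose i j ` H \<longleftrightarrow> transpose i j x \<in> H"
  by (metis imageE imageI transpose_involutory)

lemma mem_transpose_image_other: "x \<noteq> i \<Longrightarrow> x \<noteq> j \<Longrightarrow> x \<in> transpose i j ` H \<longleftrightarrow> x \<in> H"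
  by (simp add: mem_transpose_image)

lemma transpose_image_involutory [simp]: "transpose i j ` transpose i j ` H = H"
  by (auto simp: mem_transpose_image)

lemma transpose_image_eq: "i \<in> H \<longleftrightarrow> j \<in> H \<Longrightarrow> transpose i j ` H = H"
  by (auto simp: mem_transpose_image transpose_def)

lemma transpose_image_Int_eq:
  "i \<in> K \<longleftrightarrow> j \<in> K \<Longrightarrow> card (transpose i j ` H \<inter> K) = card (H \<inter> K)"
  by (metis transpose_image_eq card_image image_Int inj_transpose inj_on_subset subset_UNIV)

lemma transpose_image_Diff: "transpose i j ` H - {i, j} = H - {i, j}"
  by (auto simp: mem_transpose_image transpose_def split: if_splits)

lemma transpose_image_subset: "i \<in> S \<Longrightarrow> j \<in> S \<Longrightarrow> H \<subseteq> S \<Longrightarrow> transpose i j ` H \<subseteq> S"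
  by (auto simp: transpose_def)

lemma not_in_shift:
  assumes "H \<in> \<G>" "H \<notin> shift i j \<G>"
  shows "i \<notin> H" "j \<in> H" "transpose i j ` H \<in> shift i j \<G>" "transpose i j ` H \<notin> \<G>"
proof -
  show *: "transpose i j ` H \<notin> \<G>"
    using assms by (auto simp: shift_def)
  then have "\<not> (i \<in> H \<longleftrightarrow> j \<in> H)"
    using assms(1) transpose_image_eq[of i H j] by metis
  moreover have "\<not> (i \<in> H \<and> j \<notin> H)"
    using assms by (auto simp: shift_def)
  ultimately show "i \<notin> H" "j \<in> H" by auto
  then show "transpose i j ` H \<in> shift i j \<G>"
    using assms by (auto simp: shift_def mem_transpose_image)
qed

lemma in_shift:
  assumes "H \<in> shift i j \<G>" "H \<notin> \<G>"
  shows "i \<in> H" "j \<notin> H" "transpose i j ` H \<in> \<G>" "transpose i j ` H \<notin> shift i j \<G>"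
  using assms by (auto simp: shift_def mem_transpose_image)

lemma shift_Diff: "shift i j \<G> - \<G> = (`) (transpose i j) ` (\<G> - shift i j \<G>)" (is "?L = ?R")
proof
  show "?L \<subseteq> ?R"
  proof
    fix H assume "H \<in> ?L"
    then have "transpose i j ` H \<in> \<G> - shift i j \<G>"
      using in_shift[of H i j \<G>] by auto
    then show "H \<in> ?R"
      by (metis imageI transpose_image_involutory)
  qed
  show "?R \<subseteq> ?L"
    using not_in_shift[of _ \<G> i j] by auto
qed

text \<open>The transposition pairs the sets that leave with those that enter, so only these pairs
  contribute. For the biased weight each pair cancels; for the sum of elements each pair gives a
  decrease, which makes repeated shifting terminate.\<close>

lemma sum_shift:
  fixes f :: "'a set \<Rightarrow> 'b :: ab_group_add"
  assumes "finite \<G>" "finite (shift i j \<G>)"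
  shows "sum f (shift i j \<G>) - sum f \<G> = (\<Sum>H\<in>\<G> - shift i j \<G>. f (transpose i j ` H) - f H)"
proof -
  have inj: "inj_on ((`) (transpose i j)) (\<G> - shift i j \<G>)"
    by (metis inj_onI transpose_image_involutory)
  have "sum f (shift i j \<G>) = sum f (shift i j \<G> \<inter> \<G>) + sum f (shift i j \<G> - \<G>)"
    using sum.Int_Diff[OF assms(2)] by blast
  moreover have "sum f \<G> = sum f (shift i j \<G> \<inter> \<G>) + sum f (\<G> - shift i j \<G>)"
    using sum.Int_Diff[OF assms(1), of f "shift i j \<G>"] by (simp add: Int_commute)
  moreover have "sum f (shift i j \<G> - \<G>) = (\<Sum>H\<in>\<G> - shift i j \<G>. f (transpose i j ` H))"
    unfolding shift_Diff by (simp add: sum.reindex[OF inj])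
  ultimately show ?thesis
    by (simp add: sum_subtractf)
qed

lemma shift_subset_Pow:
  assumes "i \<in> S" "j \<in> S" "\<G> \<subseteq> Pow S"
  shows "shift i j \<G> \<subseteq> Pow S"
proof
  fix H assume "H \<in> shift i j \<G>"
  then have "H \<in> \<G> \<or> transpose i j ` H \<in> \<G>"
    by (auto simp: shift_def)
  then show "H \<in> Pow S"
    using transpose_image_subset[OF assms(1,2), of "transpose i j ` H"] assms(3) by auto
qed

lemma pmeas_shift:
  assumes "finite S" "i \<in> S" "j \<in> S" "\<G> \<subseteq> Pow S"
  shows "pmeas p S (shift i j \<G>) = pmeas p S \<G>"
proof -
  let ?w = "\<lambda>X. p ^ card X * (1 - p) ^ card (S - X)"
  have fin: "finite \<G>" "finite (shift i j \<G>)"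
    using assms shift_subset_Pow[OF assms(2-4)] finite_subset by (metis finite_Pow_iff)+
  have S: "transpose i j ` S = S"
    using assms by (intro transpose_image_eq) auto
  have "?w (transpose i j ` H) = ?w H" for H
  proof -
    have "S - transpose i j ` H = transpose i j ` (S - H)"
      using S by (simp add: image_set_diff)
    then show ?thesis
      by (simp add: card_image)
  qed
  then have "sum ?w (shift i j \<G>) - sum ?w \<G> = 0"
    unfolding sum_shift[OF fin] by simp
  then show ?thesis
    using assms(4) shift_subset_Pow[OF assms(2-4)] by (simp add: pmeas_def Int_absorb2)
qed

lemma sum_shift_less:
  assumes "finite S" "i \<in> S" "j \<in> S" "\<G> \<subseteq> Pow S" "i < j" "shift i j \<G> \<noteq> \<G>"
  shows "(\<Sum>H\<in>shift i j \<G>. \<Sum>H) < (\<Sum>H\<in>\<G>. \<Sum>(H::nat set))"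
proof -
  have fin: "finite \<G>" "finite (shift i j \<G>)"
    using assms shift_subset_Pow[OF assms(2-4)] finite_subset by (metis finite_Pow_iff)+
  \<comment> \<open>The differences are formed in \<open>int\<close> because
    \<open>sum_shift\<close> needs subtraction in a group.\<close>
  have "int (\<Sum>(transpose i j ` H)) - int (\<Sum>H) < 0" if "H \<in> \<G> - shift i j \<G>" for H
  proof -
    have H: "i \<notin> H" "j \<in> H" "finite H"
      using that not_in_shift[of H \<G> i j] assms(1,4) by (auto intro: finite_subset)
    have "\<Sum>(transpose i j ` H) = (\<Sum>x\<in>H. transpose i j x)"
      by (simp add: sum.reindex)
    also have "\<dots> < \<Sum>H"
      using H assms(5) by (intro sum_strict_mono_ex1) (auto simp: transpose_def intro!: bexI[of _ j])
    finally show ?thesis by linarith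
  qed
  moreover have "\<G> - shift i j \<G> \<noteq> {}"
    using shift_Diff[of i j \<G>] assms(6) by auto
  ultimately have "(\<Sum>H\<in>\<G> - shift i j \<G>. int (\<Sum>(transpose i j ` H)) - int (\<Sum>H)) <
      (\<Sum>H\<in>\<G> - shift i j \<G>. 0)"
    using fin by (intro sum_strict_mono) auto
  then have "(\<Sum>H\<in>shift i j \<G>. int (\<Sum>H)) - (\<Sum>H\<in>\<G>. int (\<Sum>H)) < 0"
    unfolding sum_shift[OF fin] by simp
  then show ?thesis
    by (simp flip: of_nat_sum)
qed

text \<open>The delicate case is a superset of \<open>H\<close> that gains \<open>j\<close> when
  \<open>H\<close> belongs to the shift because of \<open>i \<in> H\<close> and
  \<open>j \<notin> H\<close>. It then contains both points and is fixed by the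
  transposition.\<close>

lemma up_closed_shift:
  assumes "up_closed S \<G>" "i \<in> S" "j \<in> S"
  shows "up_closed S (shift i j \<G>)"
  unfolding up_closed_def
proof (intro ballI allI impI)
  fix H H' assume H: "H \<in> shift i j \<G>" and HH': "H \<subseteq> H' \<and> H' \<subseteq> S"
  then have up: "H \<in> \<G> \<Longrightarrow> H' \<in> \<G>" "transpose i j ` H \<in> \<G> \<Longrightarrow> transpose i j ` H' \<in> \<G>"
    using up_closedD[OF assms(1)] transpose_image_subset[OF assms(2,3), of H']
    by (blast, meson image_mono)
  show "H' \<in> shift i j \<G>"
  proof (cases "j \<in> H' \<and> i \<in> H")
    case True
    then have "transpose i j ` H' = H'"
      using HH' by (intro transpose_image_eq) auto
    then show ?thesis
      using up H by (auto simp: shift_def)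
  next
    case False
    then show ?thesis
      using up H HH' by (auto simp: shift_def)
  qed
qed

lemma three_wise_shift:
  assumes "three_wise_intersecting t \<G>" "\<G> \<subseteq> Pow S" "finite S"
  shows "three_wise_intersecting t (shift i j \<G>)"
proof -
  let ?s = "(`) (transpose i j)"
  have T: "t \<le> card (G1 \<inter> G2 \<inter> G3)" if "G1 \<in> \<G>" "G2 \<in> \<G>" "G3 \<in> \<G>" for G1 G2 G3
    using assms(1) that by (auto simp: three_wise_intersecting_def)
  \<comment> \<open>The dangerous triples combine a set \<open>A\<close> created by the shift with a
    set \<open>B\<close> whose image is not in the family. Here \<open>?s A\<close> avoids
    \<open>i\<close> and \<open>B\<close> avoids \<open>j\<close>, so \<open>?s A \<inter> B\<close>
    contains neither point and lies in \<open>A \<inter> B\<close>; the third set may be replaced by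
    any member agreeing with it off \<open>{i, j}\<close>.\<close>
  have mixed: "t \<le> card (A \<inter> B \<inter> C)"
    if "A \<in> shift i j \<G>" "B \<in> shift i j \<G>" "C \<in> shift i j \<G>" "A \<notin> \<G>" "?s B \<notin> \<G>" for A B C
  proof -
    have A: "i \<in> A" "j \<notin> A" "?s A \<in> \<G>"
      using that in_shift[of A i j \<G>] by auto
    have B: "i \<in> B" "j \<notin> B" "B \<in> \<G>"
      using that by (auto simp: shift_def)
    obtain C' where C': "C' \<in> \<G>" "C' - {i, j} = C - {i, j}"
      using \<open>C \<in> shift i j \<G>\<close> transpose_image_Diff[of i j C] by (auto simp: shift_def)
    have "?s A \<inter> B \<inter> C' \<subseteq> A \<inter> B \<inter> C"
    proof
      fix x assume x: "x \<in> ?s A \<inter> B \<inter> C'"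
      then have "x \<noteq> i" "x \<noteq> j"
        using A B by (auto simp: mem_transpose_image)
      then show "x \<in> A \<inter> B \<inter> C"
        using x C'(2) transpose_image_Diff[of i j A] by blast
    qed
    moreover have "finite (A \<inter> B \<inter> C)"
      using B assms(2,3) by (auto intro: finite_subset)
    ultimately show ?thesis
      using T[OF A(3) B(3) C'(1)] card_mono by (metis le_trans)
  qed
  show ?thesis
    unfolding three_wise_intersecting_def
  proof (intro ballI)
    fix A B C assume *: "A \<in> shift i j \<G>" "B \<in> shift i j \<G>" "C \<in> shift i j \<G>"
    have perm: "A \<inter> C \<inter> B = A \<inter> B \<inter> C" "B \<inter> A \<inter> C = A \<inter> B \<inter> C" "B \<inter> C \<inter> A = A \<inter> B \<inter> C"
      "C \<inter> A \<inter> B = A \<inter> B \<inter> C" "C \<inter> B \<inter> A = A \<inter> B \<inter> C" by auto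
    have same: "X \<in> \<G> \<or> ?s X \<in> \<G>" if "X \<in> shift i j \<G>" for X
      using that by (auto simp: shift_def)
    \<comment> \<open>Unless all three sets or all three images lie in the family, some set is
      absent and some image is absent. These belong to different sets, since of \<open>X\<close> and
      \<open>?s X\<close> at least one is present.\<close>
    consider "A \<in> \<G>" "B \<in> \<G>" "C \<in> \<G>" | "?s A \<in> \<G>" "?s B \<in> \<G>" "?s C \<in> \<G>"
      | "A \<notin> \<G>" "?s B \<notin> \<G>" | "A \<notin> \<G>" "?s C \<notin> \<G>"
      | "B \<notin> \<G>" "?s A \<notin> \<G>" | "B \<notin> \<G>" "?s C \<notin> \<G>"
      | "C \<notin> \<G>" "?s A \<notin> \<G>" | "C \<notin> \<G>" "?s B \<notin> \<G>"
      using same * by blast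
    then show "t \<le> card (A \<inter> B \<inter> C)"
    proof cases
      case 1
      then show ?thesis by (rule T)
    next
      case 2
      have "?s A \<inter> ?s B \<inter> ?s C = ?s (A \<inter> B \<inter> C)"
        by (simp add: image_Int)
      then show ?thesis
        using T[OF 2] by (simp add: card_image)
    next
      case 3 then show ?thesis using mixed * by blast
    next
      case 4 then show ?thesis using mixed[of A C B] * perm by simp
    next
      case 5 then show ?thesis using mixed[of B A C] * perm by simp
    next
      case 6 then show ?thesis using mixed[of B C A] * perm by simp
    next
      case 7 then show ?thesis using mixed[of C A B] * perm by simp
    next
      case 8 then show ?thesis using mixed[of C B A] * perm by simp
    qed
  qed
qed

section \<open>Undoing a shift\<close>

text \<open>In the bad case every member contains \<open>U = T - {i}\<close>, of size
  \<open>t - 1\<close>, and at least one of \<open>i\<close> and \<open>j\<close>, while some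
  \<open>G0\<close> misses \<open>i\<close> and some \<open>G1\<close> misses \<open>j\<close>. Two
  members containing \<open>i\<close> but not \<open>j\<close> share with \<open>G0\<close> only
  points of \<open>U\<close> and of their traces outside, so these traces intersect; likewise for
  \<open>j\<close> and \<open>G1\<close>. The constant 5 is 2 + 2 from these two groups plus 1 from
  the members containing both points.\<close>

lemma pullback_shift_F0:
  assumes S: "finite S" "i \<in> S" "j \<in> S" "\<G> \<subseteq> Pow S"
    and p: "0 < p" "p \<le> 1/2"
    and int: "three_wise_intersecting t \<G>"
    and T: "T \<subseteq> S" "card T = t" "\<And>H. H \<in> shift i j \<G> \<Longrightarrow> T \<subseteq> H"
  shows "(\<exists>T' \<subseteq> S. card T' = t \<and> (\<forall>G\<in>\<G>. T' \<subseteq> G)) \<or> pmeas p S \<G> \<le> 5 * p * p ^ t"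
proof (rule disjCI)
  assume small: "\<not> pmeas p S \<G> \<le> 5 * p * p ^ t"
  show "\<exists>T' \<subseteq> S. card T' = t \<and> (\<forall>G\<in>\<G>. T' \<subseteq> G)"
  proof (cases "\<forall>G\<in>\<G>. T \<subseteq> G")
    case True
    then show ?thesis using T by auto
  next
    case False
    then obtain G0 where G0: "G0 \<in> \<G>" "\<not> T \<subseteq> G0" by auto
    then have "G0 \<notin> shift i j \<G>"
      using T(3) by auto
    note nG0 = not_in_shift[OF G0(1) this]
    have TG0: "T \<subseteq> transpose i j ` G0"
      using T(3) nG0(3) by blast
    have jT: "j \<notin> T"
      using TG0 nG0(1) by (auto simp: subset_iff mem_transpose_image)
    have iT: "i \<in> T"
    proof (rule ccontr)
      assume "i \<notin> T"
      then have "T \<subseteq> G0"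
        using TG0 jT by (metis mem_transpose_image_other subset_iff)
      then show False using G0 by simp
    qed
    define U where "U = T - {i}"
    have finT: "finite T"
      using S(1) T(1) finite_subset by blast
    then have cU: "card U + 1 = t" "finite U"
      using iT T(2) card_Suc_Diff1[of T i] by (auto simp: U_def)
    have iU: "i \<notin> U" "j \<notin> U" "i \<noteq> j"
      using iT jT by (auto simp: U_def)
    have T_or: "T \<subseteq> G \<or> i \<notin> G \<and> j \<in> G \<and> U \<subseteq> G" if "G \<in> \<G>" for G
    proof (cases "G \<in> shift i j \<G>")
      case False
      note n = not_in_shift[OF that False]
      have "U \<subseteq> G"
      proof
        fix x assume "x \<in> U"
        then have "x \<in> transpose i j ` G" "x \<noteq> i" "x \<noteq> j"
          using T(3)[OF n(3)] iU by (auto simp: U_def)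
        then show "x \<in> G"
          by (simp add: mem_transpose_image_other)
      qed
      then show ?thesis
        using n by simp
    qed (use T(3) in auto)
    show ?thesis
    proof (cases "\<forall>G\<in>\<G>. insert j U \<subseteq> G")
      case True
      moreover have "card (insert j U) = t"
        using iU cU by simp
      ultimately show ?thesis
        using S T(1) by (intro exI[of _ "insert j U"]) (auto simp: U_def)
    next
      case False
      then obtain G1 where G1: "G1 \<in> \<G>" "\<not> insert j U \<subseteq> G1" by auto
      then have nG1: "i \<in> G1" "j \<notin> G1"
        using T_or[OF G1(1)] iT by (auto simp: U_def)
      let ?K = "insert i (insert j U)"
      let ?A = "\<lambda>c. {Z. insert c U \<union> Z \<in> \<G>}"
      have K: "?K \<subseteq> S"
        using S T(1) by (auto simp: U_def)
      have A: "pmeas p (S - ?K) (?A c) \<le> 2 * p" if "c \<in> {i, j}" "G \<in> \<G>" "c \<notin> G" for c G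
      proof (rule pmeas_intersecting_le)
        fix X Y assume XY: "X \<in> ?A c" "Y \<in> ?A c" "X \<subseteq> S - ?K" "Y \<subseteq> S - ?K"
        show "X \<inter> Y \<noteq> {}"
        proof
          assume "X \<inter> Y = {}"
          then have "(insert c U \<union> X) \<inter> (insert c U \<union> Y) \<inter> G \<subseteq> U"
            using XY that by auto
          then have "card ((insert c U \<union> X) \<inter> (insert c U \<union> Y) \<inter> G) \<le> card U"
            using cU(2) by (rule card_mono[rotated])
          moreover have "t \<le> card ((insert c U \<union> X) \<inter> (insert c U \<union> Y) \<inter> G)"
            using int XY that(2) unfolding three_wise_intersecting_def by blast
          ultimately show False using cU by simp
        qed
      qed (use S p in auto)
      have F: "pmeas p S {G \<in> \<G>. G \<inter> ?K = insert c U} \<le> p ^ t * (2 * p)"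
        if "c \<in> {i, j}" "G \<in> \<G>" "c \<notin> G" for c G
      proof -
        have "pmeas p S {G \<in> \<G>. G \<inter> ?K = insert c U} \<le>
            p ^ card (insert c U) * pmeas p (S - ?K) (?A c)"
          using that S(1) K p by (intro pmeas_fiber_le) auto
        also have "card (insert c U) = t"
          using that(1) iU cU by auto
        also have "p ^ t * pmeas p (S - ?K) (?A c) \<le> p ^ t * (2 * p)"
          using A[OF that] p by (intro mult_left_mono) auto
        finally show ?thesis .
      qed
      let ?F = "\<lambda>c. {G \<in> \<G>. G \<inter> ?K = insert c U}"
      have "pmeas p S \<G> \<le> pmeas p S (?F i \<union> ?F j \<union> {G. ?K \<subseteq> G})"
      proof (rule pmeas_mono)
        show "\<G> \<inter> Pow S \<subseteq> ?F i \<union> ?F j \<union> {G. ?K \<subseteq> G}"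
        proof
          fix G assume "G \<in> \<G> \<inter> Pow S"
          then have "G \<in> \<G>" by simp
          moreover from T_or[OF this] have "U \<subseteq> G" "i \<in> G \<or> j \<in> G"
            using iT by (auto simp: U_def)
          ultimately show "G \<in> ?F i \<union> ?F j \<union> {G. ?K \<subseteq> G}"
            using iU by auto
        qed
      qed (use S p in auto)
      also have "\<dots> \<le> pmeas p S (?F i \<union> ?F j) + pmeas p S {G. ?K \<subseteq> G}"
        using S p by (intro pmeas_Un_le) auto
      also have "pmeas p S (?F i \<union> ?F j) \<le> pmeas p S (?F i) + pmeas p S (?F j)"
        using S p by (intro pmeas_Un_le) auto
      also have "pmeas p S (?F i) \<le> p ^ t * (2 * p)"
        using F[of i G0] G0 nG0 by simp
      also have "pmeas p S (?F j) \<le> p ^ t * (2 * p)"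
        using F[of j G1] G1 nG1 by simp
      also have "pmeas p S {G. ?K \<subseteq> G} \<le> p ^ card ?K"
        using S p by (intro pmeas_superset_le) auto
      also have "card ?K = Suc t"
        using iU cU by simp
      finally show ?thesis
        using small by (simp add: algebra_simps)
    qed
  qed
qed

text \<open>At most one value exceeds 1/2, and it is at most 1; this costs the extra 1/2.\<close>

lemma sum_le_half_card:
  fixes x :: "'a \<Rightarrow> real"
  assumes "finite I" "\<And>a. a \<in> I \<Longrightarrow> x a \<le> 1"
    and "\<And>a b. a \<in> I \<Longrightarrow> b \<in> I \<Longrightarrow> a \<noteq> b \<Longrightarrow> x a + x b \<le> 1"
  shows "sum x I \<le> (real (card I) + 1) / 2"
proof (cases "\<exists>c\<in>I. x c > 1/2")
  case True
  then obtain c where c: "c \<in> I" "x c > 1/2" by auto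
  have "x a \<le> 1/2" if "a \<in> I - {c}" for a
    using assms(3)[of c a] that c by auto
  then have "sum x (I - {c}) \<le> real (card (I - {c})) * (1/2)"
    by (rule sum_bounded_above)
  moreover have "sum x I = x c + sum x (I - {c})"
    using assms(1) c(1) by (rule sum.remove)
  moreover have "card I = card (I - {c}) + 1"
    using card_Suc_Diff1[OF assms(1) c(1)] by simp
  ultimately show ?thesis
    using assms(2)[OF c(1)] by simp
next
  case False
  then have "sum x I \<le> real (card I) * (1/2)"
    by (intro sum_bounded_above) auto
  then show ?thesis by simp
qed

text \<open>Sets of the classes of \<open>a\<close> and \<open>a'\<close> share with
  \<open>G0\<close> at most the \<open>t - 1\<close> points of \<open>U - {a, a', b}\<close> and
  points of their traces, so different classes have cross-intersecting traces. Excluding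
  \<open>b\<close> from \<open>I\<close> keeps the three missing points distinct.\<close>

lemma sum_pmeas_missing_one:
  assumes "finite R" "0 \<le> p" "p \<le> 1/2" "three_wise_intersecting t \<G>"
    and U: "card U = t + 2" "finite U" "c \<notin> U" "R \<inter> insert c U = {}"
    and G0: "G0 \<in> \<G>" "c \<notin> G0" "b \<in> U" "b \<notin> G0"
    and I: "I \<subseteq> U - {b}"
  shows "(\<Sum>a\<in>I. pmeas p R {Z. insert c (U - {a}) \<union> Z \<in> \<G>}) \<le> (real (card I) + 1) / 2"
proof (rule sum_le_half_card)
  show "finite I"
    using I U(2) finite_subset by blast
  show "pmeas p R {Z. insert c (U - {a}) \<union> Z \<in> \<G>} \<le> 1" for a
    using assms by (intro pmeas_le_1) auto
  fix a a' assume a: "a \<in> I" "a' \<in> I" "a \<noteq> a'"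
  show "pmeas p R {Z. insert c (U - {a}) \<union> Z \<in> \<G>} + pmeas p R {Z. insert c (U - {a'}) \<union> Z \<in> \<G>} \<le> 1"
  proof (rule pmeas_cross_intersecting_le_1)
    fix X Y assume XY: "X \<in> {Z. insert c (U - {a}) \<union> Z \<in> \<G>}" "Y \<in> {Z. insert c (U - {a'}) \<union> Z \<in> \<G>}"
      "X \<subseteq> R" "Y \<subseteq> R"
    let ?X = "insert c (U - {a}) \<union> X" and ?Y = "insert c (U - {a'}) \<union> Y"
    show "X \<inter> Y \<noteq> {}"
    proof
      assume "X \<inter> Y = {}"
      then have "?X \<inter> ?Y \<inter> G0 \<subseteq> U - {a, a', b}"
        using XY U G0 by auto
      then have "card (?X \<inter> ?Y \<inter> G0) \<le> card (U - {a, a', b})"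
        using U(2) by (intro card_mono) auto
      moreover have "t \<le> card (?X \<inter> ?Y \<inter> G0)"
        using assms(4) XY G0(1) unfolding three_wise_intersecting_def by blast
      moreover have "{a, a', b} \<subseteq> U" "a \<noteq> b" "a' \<noteq> b"
        using a I G0 by auto
      moreover from this have "card {a, a', b} = 3"
        using a by simp
      moreover have "card {a, a', b} \<le> card U" "card (U - {a, a', b}) = card U - card {a, a', b}"
        using calculation(3) U(2) by (auto intro: card_mono card_Diff_subset)
      ultimately show False
        using U(1) by simp
    qed
  qed (use assms in auto)
qed

lemma card_Int_remove:
  assumes "finite U" "card U = Suc k" "card (G \<inter> U) = k"
  shows "\<exists>a\<in>U. G \<inter> U = U - {a}"
proof -
  have "card (U - G \<inter> U) = 1"
    using assms by (subst card_Diff_subset) auto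
  then obtain a where "U - G \<inter> U = {a}"
    by (auto simp: card_1_singleton_iff)
  then show ?thesis
    by (intro bexI[of _ a]) auto
qed

text \<open>In the bad case every member omits at most one point of \<open>U = T - {i}\<close>.
  Members omitting none, and members containing both \<open>i\<close> and \<open>j\<close>, give the
  first two terms. The others are sorted by the omitted point \<open>a\<close> and by which of
  \<open>i\<close>, \<open>j\<close> they contain. Two savings turn these \<open>2 * (t + 2)\<close>
  classes into \<open>(t + 4) / 2\<close>: for each \<open>a\<close> only one of the two classes can
  be nonempty, and traces for different \<open>a\<close> with the same choice of \<open>i\<close> or
  \<open>j\<close> are cross-intersecting, hence have measure about 1/2 on average.\<close>

lemma pullback_shift_F1:
  assumes S: "finite S" "i \<in> S" "j \<in> S" "\<G> \<subseteq> Pow S"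
    and p: "0 < p" "p \<le> 1/2"
    and int: "three_wise_intersecting t \<G>" and up: "up_closed S \<G>"
    and T: "T \<subseteq> S" "card T = t + 3" "\<And>H. H \<in> shift i j \<G> \<Longrightarrow> t + 2 \<le> card (H \<inter> T)"
  shows "(\<exists>T' \<subseteq> S. card T' = t + 3 \<and> (\<forall>G\<in>\<G>. t + 2 \<le> card (G \<inter> T'))) \<or>
    pmeas p S \<G> \<le> p ^ (t + 2) + real (t + 2) * p ^ (t + 3) + p ^ (t + 2) * (real (t + 4) / 2)"
proof (rule disjCI)
  assume small: "\<not> pmeas p S \<G> \<le> p ^ (t + 2) + real (t + 2) * p ^ (t + 3) + p ^ (t + 2) * (real (t + 4) / 2)"
  show "\<exists>T' \<subseteq> S. card T' = t + 3 \<and> (\<forall>G\<in>\<G>. t + 2 \<le> card (G \<inter> T'))"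
  proof (cases "\<forall>G\<in>\<G>. t + 2 \<le> card (G \<inter> T)")
    case True
    then show ?thesis using T by auto
  next
    case False
    then obtain G0 where G0: "G0 \<in> \<G>" "\<not> t + 2 \<le> card (G0 \<inter> T)" by auto
    then have "G0 \<notin> shift i j \<G>"
      using T(3) by auto
    note nG0 = not_in_shift[OF G0(1) this]
    have TG0: "t + 2 \<le> card (transpose i j ` G0 \<inter> T)"
      using T(3) nG0(3) by blast
    have finT: "finite T"
      using S(1) T(1) finite_subset by blast
    have ij: "i \<noteq> j"
      using nG0 by auto
    have diff: "i \<in> T \<longleftrightarrow> j \<notin> T"
      using transpose_image_Int_eq[of i T j G0] TG0 G0 by auto
    have iT: "i \<in> T" and jT: "j \<notin> T"
    proof -
      show "i \<in> T"
      proof (rule ccontr)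
        assume "i \<notin> T"
        have "transpose i j ` G0 \<inter> T \<subseteq> G0 \<inter> T"
        proof
          fix x assume x: "x \<in> transpose i j ` G0 \<inter> T"
          then have "x \<noteq> j" "x \<noteq> i"
            using \<open>i \<notin> T\<close> nG0 by (auto simp: mem_transpose_image)
          then show "x \<in> G0 \<inter> T"
            using x by (simp add: mem_transpose_image_other)
        qed
        then have "card (transpose i j ` G0 \<inter> T) \<le> card (G0 \<inter> T)"
          using finT by (intro card_mono) auto
        then show False
          using G0 TG0 by simp
      qed
      then show "j \<notin> T" using diff by simp
    qed
    define U where "U = T - {i}"
    have U: "finite U" "card U = t + 2" "i \<notin> U" "j \<notin> U" "T = insert i U"
      using finT iT jT T(2) by (auto simp: U_def)
    have sU: "transpose i j ` G \<inter> U = G \<inter> U" for G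
    proof (rule set_eqI)
      fix x
      show "x \<in> transpose i j ` G \<inter> U \<longleftrightarrow> x \<in> G \<inter> U"
        using U by (cases "x = i \<or> x = j") (auto simp del: image_iff simp: mem_transpose_image_other)
    qed
    have cT: "card (G \<inter> insert x U) = (if x \<in> G then 1 else 0) + card (G \<inter> U)" if "x \<notin> U" for x G
      using that U(1) by (auto simp: Int_insert_right)
    have big: "t + 1 \<le> card (G \<inter> U)" if "G \<in> \<G>" for G
    proof (cases "G \<in> shift i j \<G>")
      case True
      then show ?thesis using T(3)[OF True] cT[of i G] U by (auto split: if_splits)
    next
      case False
      then show ?thesis
        using T(3)[OF not_in_shift(3)[OF that False]] cT[of i "transpose i j ` G"] U
        by (auto simp: sU split: if_splits)
    qed
    \<comment> \<open>A set containing neither \<open>i\<close> nor \<open>j\<close> is fixed by the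
      transposition and so survives the shift. Any surviving set without \<open>i\<close> must find
      its \<open>t + 2\<close> points of \<open>T\<close> in \<open>U\<close>, which has no
      more.\<close>
    have both: "U \<subseteq> G" if "G \<in> \<G>" "i \<notin> G" "j \<notin> G \<or> G \<in> shift i j \<G>" for G
    proof -
      have "G \<in> shift i j \<G>"
        using that transpose_image_eq[of i G j] by (auto simp: shift_def)
      then have "t + 2 \<le> card (G \<inter> U)"
        using T(3) cT[of i G] U that by fastforce
      then have "G \<inter> U = U"
        using U by (intro card_seteq) auto
      then show ?thesis by auto
    qed
    show ?thesis
    proof (cases "\<forall>G\<in>\<G>. t + 2 \<le> card (G \<inter> insert j U)")
      case True
      then show ?thesis
        using S T U by (intro exI[of _ "insert j U"]) auto
    next
      case False
      then obtain G1 where G1: "G1 \<in> \<G>" "\<not> t + 2 \<le> card (G1 \<inter> insert j U)" by auto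
      have jG1: "j \<notin> G1" and cG1: "card (G1 \<inter> U) = t + 1"
        using cT[of j G1] big[OF G1(1)] G1 U by (auto split: if_splits)
      have iG1: "i \<in> G1"
      proof (rule ccontr)
        assume "i \<notin> G1"
        then have "G1 \<inter> U = U" using both[OF G1(1)] jG1 by auto
        then show False using cG1 U by simp
      qed
      have cG0: "card (G0 \<inter> U) = t + 1"
        using G0 nG0 big[OF G0(1)] cT[of i G0] U by auto
      obtain b0 where b0: "b0 \<in> U" "G0 \<inter> U = U - {b0}"
        using card_Int_remove[of U "t + 1" G0] cG0 U by auto
      obtain b1 where b1: "b1 \<in> U" "G1 \<inter> U = U - {b1}"
        using card_Int_remove[of U "t + 1" G1] cG1 U by auto
      let ?K = "insert i (insert j U)"
      let ?R = "S - ?K"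
      let ?A = "\<lambda>c a. {Z. insert c (U - {a}) \<union> Z \<in> \<G>}"
      have K: "?K \<subseteq> S"
        using S T U by auto
      \<comment> \<open>Up-closedness enters here: a nonempty trace family contains all of
        \<open>?R\<close>, so membership of \<open>?R\<close> tests nonemptiness.\<close>
      have Rmem: "?R \<in> ?A c a" if "Z \<in> ?A c a" "Z \<subseteq> ?R" "c \<in> {i, j}" for Z c a
        using up_closedD[OF up, of "insert c (U - {a}) \<union> Z" "insert c (U - {a}) \<union> ?R"] that K by auto
      \<comment> \<open>Otherwise \<open>?H\<close> and its image are both members, so the shift
        keeps \<open>?H\<close>, although it meets \<open>T\<close> in only \<open>t + 1\<close>
        points.\<close>
      have not_both: False if "?R \<in> ?A i a" "?R \<in> ?A j a" "a \<in> U" for a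
      proof -
        let ?H = "insert j (U - {a}) \<union> ?R"
        have "transpose i j ` ?H = insert i (U - {a}) \<union> ?R"
          using U ij by (auto simp: mem_transpose_image transpose_def split: if_splits)
        then have "?H \<in> shift i j \<G>"
          using that by (auto simp: shift_def)
        moreover have "?H \<inter> U = U - {a}" "i \<notin> ?H"
          using U ij by auto
        ultimately have "t + 2 \<le> card (U - {a})"
          using T(3)[of ?H] cT[of i ?H] U by simp
        then show False
          using that(3) U by simp
      qed
      define I where "I = {a \<in> U. ?R \<in> ?A i a}"
      define J where "J = {a \<in> U. ?R \<in> ?A j a}"
      have IJ: "I \<inter> J = {}" "I \<union> J \<subseteq> U" "finite I" "finite J"
        using not_both U(1) by (auto simp: I_def J_def)
      have zero: "pmeas p ?R (?A c a) = 0" if "?R \<notin> ?A c a" "c \<in> {i, j}" for c a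
        using Rmem[of _ c a] that by (intro pmeas_empty) auto
      have sumI: "(\<Sum>a\<in>U. pmeas p ?R (?A i a)) = (\<Sum>a\<in>I. pmeas p ?R (?A i a))"
        using zero U(1) by (intro sum.mono_neutral_right) (auto simp: I_def)
      have sumJ: "(\<Sum>a\<in>U. pmeas p ?R (?A j a)) = (\<Sum>a\<in>J. pmeas p ?R (?A j a))"
        using zero U(1) by (intro sum.mono_neutral_right) (auto simp: J_def)
      have G0S: "G0 \<subseteq> S" "G1 \<subseteq> S"
        using S G0 G1 by auto
      \<comment> \<open>\<open>G0\<close> witnesses that the class of \<open>j\<close> at
        \<open>b0\<close> is nonempty, so \<open>b0\<close> is not in \<open>I\<close>. This is the
        distinctness needed to use \<open>G0\<close> as the third set for the classes of
        \<open>i\<close>; \<open>G1\<close> and \<open>b1\<close> do the same for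
        \<open>J\<close>.\<close>
      have "insert j (U - {b0}) \<union> (G0 - ?K) = G0"
        using b0 nG0 by auto
      then have "G0 - ?K \<in> ?A j b0"
        using G0 by simp
      then have "?R \<in> ?A j b0"
        using Rmem[of "G0 - ?K" j b0] G0S by auto
      then have "b0 \<in> J"
        using b0 by (auto simp: J_def)
      then have Ib: "I \<subseteq> U - {b0}"
        using IJ by auto
      have "insert i (U - {b1}) \<union> (G1 - ?K) = G1"
        using b1 iG1 jG1 by auto
      then have "G1 - ?K \<in> ?A i b1"
        using G1 by simp
      then have "?R \<in> ?A i b1"
        using Rmem[of "G1 - ?K" i b1] G0S by auto
      then have "b1 \<in> I"
        using b1 by (auto simp: I_def)
      then have Jb: "J \<subseteq> U - {b1}"
        using IJ by auto
      have "(\<Sum>a\<in>I. pmeas p ?R (?A i a)) \<le> (real (card I) + 1) / 2"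
        using S p int U G0 nG0 b0 Ib
        by (intro sum_pmeas_missing_one[where t = t and b = b0 and ?G0.0 = G0]) auto
      moreover have "(\<Sum>a\<in>J. pmeas p ?R (?A j a)) \<le> (real (card J) + 1) / 2"
        using S p int U G1 jG1 b1 Jb
        by (intro sum_pmeas_missing_one[where t = t and b = b1 and ?G0.0 = G1]) auto
      moreover have "card I + card J \<le> t + 2"
        using IJ U card_Un_disjoint[of I J] card_mono[of U "I \<union> J"] by simp
      ultimately have sumIJ: "(\<Sum>a\<in>U. pmeas p ?R (?A i a)) + (\<Sum>a\<in>U. pmeas p ?R (?A j a)) \<le> real (t + 4) / 2"
        unfolding sumI sumJ by simp
      let ?F = "\<lambda>c. \<Union>a\<in>U. {G \<in> \<G>. G \<inter> ?K = insert c (U - {a})}"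
      let ?B = "\<Union>a\<in>U. {G. insert i (insert j (U - {a})) \<subseteq> G}"
      have F: "pmeas p S (?F c) \<le> p ^ (t + 2) * (\<Sum>a\<in>U. pmeas p ?R (?A c a))" if "c \<in> {i, j}" for c
      proof -
        have "pmeas p S (?F c) \<le> (\<Sum>a\<in>U. pmeas p S {G \<in> \<G>. G \<inter> ?K = insert c (U - {a})})"
          using S p U by (intro pmeas_UN_le) auto
        also have "\<dots> \<le> (\<Sum>a\<in>U. p ^ (t + 2) * pmeas p ?R (?A c a))"
        proof (rule sum_mono)
          fix a assume a: "a \<in> U"
          then have "card (insert c (U - {a})) = t + 2"
            using U that by (auto simp: card_insert_if)
          then show "pmeas p S {G \<in> \<G>. G \<inter> ?K = insert c (U - {a})} \<le> p ^ (t + 2) * pmeas p ?R (?A c a)"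
            using pmeas_fiber_le[of S p "insert c (U - {a})" ?K \<G>] S p K that by auto
        qed
        finally show ?thesis by (simp add: sum_distrib_left)
      qed
      have "pmeas p S \<G> \<le> pmeas p S ({G. U \<subseteq> G} \<union> ?B \<union> (?F i \<union> ?F j))"
      proof (rule pmeas_mono)
        show "\<G> \<inter> Pow S \<subseteq> {G. U \<subseteq> G} \<union> ?B \<union> (?F i \<union> ?F j)"
        proof
          fix G assume "G \<in> \<G> \<inter> Pow S"
          then have G: "G \<in> \<G>" by simp
          show "G \<in> {G. U \<subseteq> G} \<union> ?B \<union> (?F i \<union> ?F j)"
          proof (cases "U \<subseteq> G")
            case False
            then have "card (G \<inter> U) \<noteq> card U"
              using U(1) card_seteq[of U "G \<inter> U"] by auto
            moreover have "card (G \<inter> U) \<le> card U"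
              using U(1) by (intro card_mono) auto
            ultimately have "card (G \<inter> U) = t + 1"
              using big[OF G] U by simp
            then obtain a where a: "a \<in> U" "G \<inter> U = U - {a}"
              using card_Int_remove[of U "t + 1" G] U by auto
            consider "i \<in> G" "j \<in> G" | "i \<in> G" "j \<notin> G" | "i \<notin> G" "j \<in> G"
              using both[OF G] False by auto
            then show ?thesis
            proof cases
              case 1
              then have "insert i (insert j (U - {a})) \<subseteq> G" using a by auto
              then show ?thesis using a by blast
            next
              case 2
              then have "G \<inter> ?K = insert i (U - {a})" using a by auto
              then show ?thesis using a G by blast
            next
              case 3
              then have "G \<inter> ?K = insert j (U - {a})" using a by auto
              then show ?thesis using a G by blast
            qed
          qed auto
        qed
      qed (use S p in auto)
      also have "\<dots> \<le> pmeas p S ({G. U \<subseteq> G} \<union> ?B) + pmeas p S (?F i \<union> ?F j)"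
        using S p by (intro pmeas_Un_le) auto
      also have "pmeas p S ({G. U \<subseteq> G} \<union> ?B) \<le> pmeas p S {G. U \<subseteq> G} + pmeas p S ?B"
        using S p by (intro pmeas_Un_le) auto
      also have "pmeas p S {G. U \<subseteq> G} \<le> p ^ (t + 2)"
        using pmeas_superset_le[of S p U] S p U by simp
      also have "pmeas p S ?B \<le> real (card U) * p ^ (t + 3)"
      proof (rule pmeas_UN_le_const)
        fix a assume "a \<in> U"
        then have "card (insert i (insert j (U - {a}))) = t + 3"
          using U ij by (simp add: card_insert_if)
        then show "pmeas p S {G. insert i (insert j (U - {a})) \<subseteq> G} \<le> p ^ (t + 3)"
          using pmeas_superset_le[of S p "insert i (insert j (U - {a}))"] S p by simp
      qed (use S p U in auto)
      also have "real (card U) = real (t + 2)"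
        using U by simp
      also have "pmeas p S (?F i \<union> ?F j) \<le> pmeas p S (?F i) + pmeas p S (?F j)"
        using S p by (intro pmeas_Un_le) auto
      also have "pmeas p S (?F i) \<le> p ^ (t + 2) * (\<Sum>a\<in>U. pmeas p ?R (?A i a))"
        by (rule F) simp
      also have "pmeas p S (?F j) \<le> p ^ (t + 2) * (\<Sum>a\<in>U. pmeas p ?R (?A j a))"
        by (rule F) simp
      finally have "pmeas p S \<G> \<le> p ^ (t + 2) + real (t + 2) * p ^ (t + 3) +
          p ^ (t + 2) * ((\<Sum>a\<in>U. pmeas p ?R (?A i a)) + (\<Sum>a\<in>U. pmeas p ?R (?A j a)))"
        by (simp add: algebra_simps)
      also have "\<dots> \<le> p ^ (t + 2) + real (t + 2) * p ^ (t + 3) + p ^ (t + 2) * (real (t + 4) / 2)"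
        using sumIJ p by (intro add_left_mono mult_left_mono) auto
      finally show ?thesis
        using small by simp
    qed
  qed
qed

section \<open>Shifted families\<close>

lemma pmeas_card_Int_ge:
  assumes "finite S" "0 \<le> p" "p \<le> 1" "finite K"
  shows "pmeas p S {G. m \<le> card (G \<inter> K)} \<le> real (card K choose m) * p ^ m"
proof -
  let ?I = "{E. E \<subseteq> K \<and> card E = m}"
  have "{G. m \<le> card (G \<inter> K)} \<subseteq> (\<Union>E\<in>?I. {G. E \<subseteq> G})"
  proof
    fix G assume "G \<in> {G. m \<le> card (G \<inter> K)}"
    then obtain E where "E \<subseteq> G \<inter> K" "card E = m"
      using obtain_subset_with_card_n by blast
    then show "G \<in> (\<Union>E\<in>?I. {G. E \<subseteq> G})" by auto
  qed
  then have "pmeas p S {G. m \<le> card (G \<inter> K)} \<le> pmeas p S (\<Union>E\<in>?I. {G. E \<subseteq> G})"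
    using assms by (intro pmeas_mono) auto
  also have "\<dots> \<le> real (card ?I) * p ^ m"
    using assms pmeas_superset_le[of S p] by (intro pmeas_UN_le_const) auto
  finally show ?thesis
    using assms(4) by (simp add: n_subsets)
qed

section \<open>Shifted families and domination of prefix counts\<close>

definition shifted :: "nat \<Rightarrow> nat set set \<Rightarrow> bool" where
  "shifted n \<G> \<longleftrightarrow> (\<forall>i\<in>{1..n}. \<forall>j\<in>{1..n}. i < j \<longrightarrow> shift i j \<G> = \<G>)"

lemma shiftedD:
  assumes "shifted n \<G>" "G \<in> \<G>" "i \<in> {1..n}" "j \<in> {1..n}" "i < j" "j \<in> G" "i \<notin> G"
  shows "insert i (G - {j}) \<in> \<G>"
proof -
  have "shift i j \<G> = \<G>"
    using assms by (auto simp: shifted_def)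
  then have "G \<in> shift i j \<G>"
    using assms(2) by simp
  then have "transpose i j ` G \<in> \<G>"
    using assms(7) by (auto simp: shift_def)
  moreover have "transpose i j ` G = insert i (G - {j})"
    using assms(5-7) by (auto simp: mem_transpose_image transpose_def split: if_splits)
  ultimately show ?thesis by simp
qed

text \<open>The smallest element \<open>x\<close> of \<open>G - H\<close> is exchanged for a smaller
  \<open>y\<close> in \<open>H - G\<close>, which brings \<open>G\<close> closer to
  \<open>H\<close>. Such a \<open>y\<close> exists, since otherwise \<open>H\<close> would have
  fewer elements than \<open>G\<close> up to \<open>x\<close>.\<close>

lemma shifted_dominating:
  assumes "shifted n \<G>" "up_closed {1..n} \<G>" "\<G> \<subseteq> Pow {1..n}"
    and "G \<in> \<G>" "H \<subseteq> {1..n}" "\<And>k. k \<le> n \<Longrightarrow> card (G \<inter> {1..k}) \<le> card (H \<inter> {1..k})"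
  shows "H \<in> \<G>"
  using assms(4,6)
proof (induction "card (G - H)" arbitrary: G rule: less_induct)
  case less
  have GS: "G \<subseteq> {1..n}" and fin: "finite G" "finite H"
    using less.prems(1) assms(3,5) finite_subset by blast+
  show ?case
  proof (cases "G - H = {}")
    case True
    then show ?thesis
      using up_closedD[OF assms(2) less.prems(1)] assms(5) by blast
  next
    case False
    define x where "x = Min (G - H)"
    have x: "x \<in> G" "x \<notin> H"
      using Min_in[of "G - H"] False fin by (auto simp: x_def)
    have x_min: "z \<in> H" if "z \<in> G" "z < x" for z
      using Min_le[of "G - H" z] that fin unfolding x_def by (meson DiffI finite_Diff not_less)
    have "\<exists>y\<in>H - G. y < x"
    proof (rule ccontr)
      assume "\<not> ?thesis"
      then have "H \<inter> {1..x} \<subseteq> G \<inter> {1..x} - {x}"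
        using x by (auto simp: not_less) (metis Diff_iff le_antisym)
      then have "card (H \<inter> {1..x}) \<le> card (G \<inter> {1..x} - {x})"
        by (intro card_mono) auto
      also have "\<dots> < card (G \<inter> {1..x})"
        using x GS by (intro card_Diff1_less) auto
      finally show False
        using less.prems(2)[of x] x GS by (auto simp: subset_iff)
    qed
    then obtain y where y: "y \<in> H" "y \<notin> G" "y < x" by auto
    define G' where "G' = insert y (G - {x})"
    have "G' \<in> \<G>"
      unfolding G'_def using x y GS assms(5) by (intro shiftedD[OF assms(1) less.prems(1)]) auto
    moreover have "card (G' - H) < card (G - H)"
    proof -
      have "G' - H = (G - H) - {x}"
        using y by (auto simp: G'_def)
      then show ?thesis
        using x fin by (metis DiffI card_Diff1_less finite_Diff)
    qed
    moreover have "card (G' \<inter> {1..k}) \<le> card (H \<inter> {1..k})" if "k \<le> n" for k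
    proof -
      consider "k < y" | "y \<le> k" "k < x" | "x \<le> k" by linarith
      then show ?thesis
      proof cases
        case 1
        then have "G' \<inter> {1..k} = G \<inter> {1..k}"
          using y by (auto simp: G'_def)
        then show ?thesis
          using less.prems(2)[OF that] by simp
      next
        case 2
        \<comment> \<open>Only in this range has the prefix count gone up, but below
          \<open>x\<close> all elements of \<open>G'\<close> lie in \<open>H\<close>.\<close>
        then have "G' \<inter> {1..k} \<subseteq> H \<inter> {1..k}"
          using y x_min by (auto simp: G'_def)
        then show ?thesis
          by (intro card_mono) auto
      next
        case 3
        have "y \<ge> 1"
          using y assms(5) by auto
        then have "G' \<inter> {1..k} = insert y (G \<inter> {1..k} - {x})"
          using 3 y by (auto simp: G'_def)
        then have "card (G' \<inter> {1..k}) = Suc (card (G \<inter> {1..k} - {x}))"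
          using y by simp
        also have "\<dots> = card (G \<inter> {1..k})"
          using x GS 3 by (intro card_Suc_Diff1) auto
        finally show ?thesis
          using less.prems(2)[OF that] by simp
      qed
    qed
    ultimately show ?thesis
      by (intro less.hyps) auto
  qed
qed

lemma card_Int_atLeastAtMost_le_add:
  assumes "m \<le> k"
  shows "card (G \<inter> {1..k}) \<le> card (G \<inter> {1..m}) + (k - m)"
proof -
  have "G \<inter> {1..k} \<subseteq> (G \<inter> {1..m}) \<union> {m<..k}"
    by auto
  then have "card (G \<inter> {1..k}) \<le> card ((G \<inter> {1..m}) \<union> {m<..k})"
    by (intro card_mono) auto
  also have "\<dots> \<le> card (G \<inter> {1..m}) + card {m<..k}"
    by (rule card_Un_le)
  finally show ?thesis by simp
qed

text \<open>A member that never reaches the required count misses at least \<open>j + 1\<close>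
  points of \<open>{1..t + 3 * j}\<close> for every \<open>j\<close>. It is then dominated by each
  \<open>H r\<close>, which contains everything below \<open>t\<close> and from \<open>t\<close> on
  misses one residue class modulo 3. The three sets \<open>H 0\<close>, \<open>H 1\<close>,
  \<open>H 2\<close> have only \<open>{1..<t}\<close> in common, one point too few.\<close>

lemma shifted_hitting:
  assumes "shifted n \<G>" "up_closed {1..n} \<G>" "\<G> \<subseteq> Pow {1..n}"
    and "three_wise_intersecting t \<G>" "0 < t" "G \<in> \<G>"
  shows "\<exists>j. t + 2 * j \<le> card (G \<inter> {1..t + 3 * j})"
proof (rule ccontr)
  assume "\<not> ?thesis"
  then have less: "card (G \<inter> {1..t + 3 * j}) < t + 2 * j" for j
    by (auto simp: not_le)
  define H where "H r = {x\<in>{1..n}. \<not> (t \<le> x \<and> (x - t) mod 3 = r)}" for r :: nat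
  have "H r \<in> \<G>" for r
  proof (rule shifted_dominating[OF assms(1-3,6)])
    fix k assume k: "k \<le> n"
    show "card (G \<inter> {1..k}) \<le> card (H r \<inter> {1..k})"
    proof (cases "k < t")
      case True
      then have "G \<inter> {1..k} \<subseteq> H r \<inter> {1..k}"
        using k by (auto simp: H_def)
      then show ?thesis by (intro card_mono) auto
    next
      case False
      define j where "j = (k - t) div 3"
      have kj: "t + 3 * j \<le> k" "k < t + 3 * j + 3"
        using False by (auto simp: j_def)
      have "card (G \<inter> {1..k}) \<le> card (G \<inter> {1..t + 3 * j}) + (k - (t + 3 * j))"
        using kj by (intro card_Int_atLeastAtMost_le_add)
      then have 1: "card (G \<inter> {1..k}) + (j + 1) \<le> k"
        using less[of j] kj by linarith
      have "{1..k} - H r \<subseteq> (\<lambda>i. t + 3 * i + r) ` {..j}"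
      proof
        fix x assume x: "x \<in> {1..k} - H r"
        then have xt: "t \<le> x" "(x - t) mod 3 = r"
          using k by (auto simp: H_def)
        have "(x - t) div 3 \<le> j"
          unfolding j_def using x by (intro div_le_mono) auto
        moreover have "x = t + 3 * ((x - t) div 3) + r"
          using xt mult_div_mod_eq[of 3 "x - t"] by linarith
        ultimately show "x \<in> (\<lambda>i. t + 3 * i + r) ` {..j}" by blast
      qed
      then have "card ({1..k} - H r) \<le> card ((\<lambda>i. t + 3 * i + r) ` {..j})"
        by (intro card_mono) auto
      also have "\<dots> \<le> card {..j}"
        by (rule card_image_le) auto
      finally have 2: "card ({1..k} - H r) \<le> j + 1" by simp
      have "card {1..k} = card ({1..k} \<inter> H r) + card ({1..k} - H r)"
        by (rule card_Int_Diff) auto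
      then show ?thesis
        using 1 2 by (simp add: Int_commute)
    qed
  qed (auto simp: H_def)
  then have "t \<le> card (H 0 \<inter> H 1 \<inter> H 2)"
    using assms(4) unfolding three_wise_intersecting_def by blast
  moreover have "H 0 \<inter> H 1 \<inter> H 2 \<subseteq> {1..<t}"
  proof
    fix x assume x: "x \<in> H 0 \<inter> H 1 \<inter> H 2"
    have "(x - t) mod 3 \<in> {0, 1, 2}" by auto
    then show "x \<in> {1..<t}"
      using x by (auto simp: H_def)
  qed
  then have "card (H 0 \<inter> H 1 \<inter> H 2) \<le> card {1..<t}"
    by (intro card_mono) auto
  ultimately show False
    using assms(5) by simp
qed

text \<open>\<open>G\<close> has at most \<open>t + 2 * j - 1\<close> elements up to
  \<open>t + 3 * j\<close>. Packing that many at the start, leaving the next \<open>j + 1\<close>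
  points empty and taking everything afterwards dominates \<open>G\<close>.\<close>

lemma shifted_missing_interval:
  assumes "shifted n \<G>" "up_closed {1..n} \<G>" "\<G> \<subseteq> Pow {1..n}"
    and "0 < t" "G \<in> \<G>" "card (G \<inter> {1..t + 3 * j}) < t + 2 * j"
  shows "{1..n} - {t + 2 * j..t + 3 * j} \<in> \<G>"
proof (rule shifted_dominating[OF assms(1-3,5)])
  let ?H = "{1..n} - {t + 2 * j..t + 3 * j}"
  fix k assume k: "k \<le> n"
  consider "k < t + 2 * j" | "t + 2 * j \<le> k" "k < t + 3 * j" | "t + 3 * j \<le> k" by linarith
  then show "card (G \<inter> {1..k}) \<le> card (?H \<inter> {1..k})"
  proof cases
    case 1
    then have "G \<inter> {1..k} \<subseteq> ?H \<inter> {1..k}"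
      using k by auto
    then show ?thesis by (intro card_mono) auto
  next
    case 2
    have "card (G \<inter> {1..k}) \<le> card (G \<inter> {1..t + 3 * j})"
      using 2 by (intro card_mono) auto
    also have "\<dots> \<le> card {1..<t + 2 * j}"
      using assms(6) by simp
    also have "\<dots> \<le> card (?H \<inter> {1..k})"
      using 2 k by (intro card_mono) auto
    finally show ?thesis .
  next
    case 3
    have "card (G \<inter> {1..k}) \<le> card (G \<inter> {1..t + 3 * j}) + (k - (t + 3 * j))"
      using 3 by (rule card_Int_atLeastAtMost_le_add)
    moreover have "?H \<inter> {1..k} = {1..k} - {t + 2 * j..t + 3 * j}"
      using k by auto
    moreover have "card ({1..k} - {t + 2 * j..t + 3 * j}) = card {1..k} - card {t + 2 * j..t + 3 * j}"
      using 3 assms(4) by (intro card_Diff_subset) auto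
    ultimately show ?thesis
      using assms(6) 3 by simp
  qed
qed auto

(* If the family is not contained in F_j, then it contains the set missing exactly {t+2j..t+3j}.
   A member of F_j whose j missing points D lie below t+j can be shifted to miss {t+j..<t+2j}
   instead; as these three sets of missing points are disjoint, 3-wise t-intersection forces the
   traces outside {1..t+3j} to be pairwise intersecting. *)
lemma pmeas_shifted_Int_F_le:
  assumes "shifted n \<G>" "up_closed {1..n} \<G>" "\<G> \<subseteq> Pow {1..n}"
    and int: "three_wise_intersecting t \<G>" and "0 < t" and p: "0 < p" "p \<le> 1/2"
    and not: "G0 \<in> \<G>" "card (G0 \<inter> {1..t + 3 * j}) < t + 2 * j"
  shows "pmeas p {1..n} {G \<in> \<G>. t + 2 * j \<le> card (G \<inter> {1..t + 3 * j})} \<le>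
    real (t + 3 * j choose (t + 2 * j + 1)) * p ^ (t + 2 * j + 1) +
    (real (t + 3 * j choose j) - real (t + j - 1 choose j)) * p ^ (t + 2 * j) +
    real (t + j - 1 choose j) * (p ^ (t + 2 * j) * (2 * p))"
proof -
  let ?S = "{1..n}" and ?K = "{1..t + 3 * j}"
  \<comment> \<open>\<open>D\<close> stands for the points of \<open>?K\<close> missing from a
    member with exactly \<open>t + 2 * j\<close> points in \<open>?K\<close>. For fixed
    \<open>j\<close>, all but O(t^(j-1)) of the \<open>j\<close>-subsets lie in \<open>?E\<close>;
    with t p^2 bounded, the exceptions have measure O(p^2) relative to p^t.\<close>
  let ?E = "{D. D \<subseteq> {1..t + j - 1} \<and> card D = j}"
  let ?E' = "{D. D \<subseteq> ?K \<and> card D = j} - ?E"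
  let ?X1 = "{G. t + 2 * j + 1 \<le> card (G \<inter> ?K)}"
  let ?X2 = "\<Union>D\<in>?E'. {G. ?K - D \<subseteq> G}"
  let ?X3 = "\<Union>D\<in>?E. {G \<in> \<G>. G \<inter> ?K = ?K - D}"
  have finE: "finite ?E" "finite {D. D \<subseteq> ?K \<and> card D = j}"
    by auto
  have sub: "{1..t + j - 1} \<subseteq> ?K"
    by auto
  then have EK: "?E \<subseteq> {D. D \<subseteq> ?K \<and> card D = j}"
    by blast
  have cE: "card ?E = (t + j - 1 choose j)"
    by (simp add: n_subsets)
  have "card ?E' = (t + 3 * j choose j) - (t + j - 1 choose j)"
    using finE EK by (subst card_Diff_subset) (simp_all add: n_subsets)
  moreover have "(t + j - 1 choose j) \<le> (t + 3 * j choose j)"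
    using card_mono[OF finE(2) EK] by (simp add: n_subsets)
  ultimately have cE': "real (card ?E') = real (t + 3 * j choose j) - real (t + j - 1 choose j)"
    by simp
  have cKD: "card (?K - D) = t + 2 * j" if "D \<subseteq> ?K" "card D = j" for D
    using that by (subst card_Diff_subset) (auto intro: finite_subset)
  have "pmeas p ?S {G \<in> \<G>. t + 2 * j \<le> card (G \<inter> ?K)} \<le> pmeas p ?S (?X1 \<union> ?X2 \<union> ?X3)"
  proof (rule pmeas_mono)
    show "{G \<in> \<G>. t + 2 * j \<le> card (G \<inter> ?K)} \<inter> Pow ?S \<subseteq> ?X1 \<union> ?X2 \<union> ?X3"
    proof
      fix G assume "G \<in> {G \<in> \<G>. t + 2 * j \<le> card (G \<inter> ?K)} \<inter> Pow ?S"
      then have G: "G \<in> \<G>" "t + 2 * j \<le> card (G \<inter> ?K)" by auto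
      show "G \<in> ?X1 \<union> ?X2 \<union> ?X3"
      proof (cases "card (G \<inter> ?K) = t + 2 * j")
        case True
        define D where "D = ?K - G"
        have "card D = j"
          unfolding D_def using True card_Int_Diff[of ?K G] by (simp add: Int_commute)
        moreover have "G \<inter> ?K = ?K - D" "D \<subseteq> ?K"
          by (auto simp: D_def)
        ultimately show ?thesis
          using G(1) by (cases "D \<in> ?E") auto
      qed (use G in auto)
    qed
  qed (use p in auto)
  also have "\<dots> \<le> pmeas p ?S (?X1 \<union> ?X2) + pmeas p ?S ?X3"
    using p by (intro pmeas_Un_le) auto
  also have "pmeas p ?S (?X1 \<union> ?X2) \<le> pmeas p ?S ?X1 + pmeas p ?S ?X2"
    using p by (intro pmeas_Un_le) auto
  also have "pmeas p ?S ?X1 \<le> real (card ?K choose (t + 2 * j + 1)) * p ^ (t + 2 * j + 1)"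
    using p by (intro pmeas_card_Int_ge) auto
  also have "card ?K = t + 3 * j" by simp
  also have "pmeas p ?S ?X2 \<le> real (card ?E') * p ^ (t + 2 * j)"
  proof (rule pmeas_UN_le_const)
    fix D assume "D \<in> ?E'"
    then have "card (?K - D) = t + 2 * j"
      by (intro cKD) auto
    then show "pmeas p ?S {G. ?K - D \<subseteq> G} \<le> p ^ (t + 2 * j)"
      using pmeas_superset_le[of ?S p "?K - D"] p by simp
  qed (use p finE in auto)
  also note cE'
  also have "pmeas p ?S ?X3 \<le> real (card ?E) * (p ^ (t + 2 * j) * (2 * p))"
  proof (rule pmeas_UN_le_const)
    fix D assume D: "D \<in> ?E"
    show "pmeas p ?S {G \<in> \<G>. G \<inter> ?K = ?K - D} \<le> p ^ (t + 2 * j) * (2 * p)"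
    proof (cases "t + 3 * j \<le> n")
      case False
      \<comment> \<open>The ground set is too small: every set of this class would contain a point
        outside it.\<close>
      have "t + 3 * j \<in> ?K - D"
        using D assms(5) by auto
      moreover have "t + 3 * j \<notin> ?S"
        using False by simp
      ultimately have "{G \<in> \<G>. G \<inter> ?K = ?K - D} \<inter> Pow ?S = {}"
        by blast
      then show ?thesis
        using p by (simp add: pmeas_empty)
    next
      case True
      let ?A = "{Z. (?K - D) \<union> Z \<in> \<G>}"
      let ?D = "{t + j..<t + 2 * j}" and ?B = "{t + 2 * j..t + 3 * j}"
      have DK: "D \<subseteq> ?K" "card D = j" "finite D"
        using D sub finite_subset[of D "{1..t + j - 1}"] by blast+
      have Dlt: "x < t + j" if "x \<in> D" for x
      proof -
        have "x \<in> {1..t + j - 1}"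
          using D that by blast
        then show ?thesis
          using assms(5) unfolding atLeastAtMost_iff by linarith
      qed
      have "pmeas p (?S - ?K) ?A \<le> 2 * p"
      proof (rule pmeas_intersecting_le)
        fix X Y assume XY: "X \<in> ?A" "Y \<in> ?A" "X \<subseteq> ?S - ?K" "Y \<subseteq> ?S - ?K"
        \<comment> \<open>The new gap \<open>?D\<close> has the size of \<open>D\<close> and lies
          above it, so moving the gap up gives a dominating set.\<close>
        have Y': "(?K - ?D) \<union> Y \<in> \<G>"
        proof (rule shifted_dominating[OF assms(1-3), of "(?K - D) \<union> Y"])
          fix k assume k: "k \<le> n"
          show "card (((?K - D) \<union> Y) \<inter> {1..k}) \<le> card (((?K - ?D) \<union> Y) \<inter> {1..k})"
          proof (cases "k < t + j")
            case True
            then have "((?K - D) \<union> Y) \<inter> {1..k} \<subseteq> ((?K - ?D) \<union> Y) \<inter> {1..k}"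
              by auto
            then show ?thesis
              by (intro card_mono) auto
          next
            case False
            have split: "card (((?K - C) \<union> Y) \<inter> {1..k}) = card (?K \<inter> {1..k} - C) + card (Y \<inter> {1..k})"
              for C :: "nat set"
            proof -
              have "((?K - C) \<union> Y) \<inter> {1..k} = (?K \<inter> {1..k} - C) \<union> (Y \<inter> {1..k})"
                by auto
              also have "card \<dots> = card (?K \<inter> {1..k} - C) + card (Y \<inter> {1..k})"
                using XY(4) by (intro card_Un_disjoint) auto
              finally show ?thesis .
            qed
            have "D \<subseteq> ?K \<inter> {1..k}"
              using DK(1) Dlt False by force
            then have "card (?K \<inter> {1..k} - D) = card (?K \<inter> {1..k}) - j"
              using DK by (simp add: card_Diff_subset)
            moreover have "card (?K \<inter> {1..k}) - card ?D \<le> card (?K \<inter> {1..k} - ?D)"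
              by (rule diff_card_le_card_Diff) simp
            ultimately show ?thesis
              unfolding split by simp
          qed
        qed (use XY True in auto)
        have B: "?S - ?B \<in> \<G>"
          using not by (intro shifted_missing_interval[OF assms(1-3,5)])
        \<comment> \<open>The disjoint gaps have \<open>j + j + (j + 1)\<close> points in total,
          which leaves only \<open>t - 1\<close> of the \<open>t + 3 * j\<close> points of
          \<open>?K\<close>.\<close>
        show "X \<inter> Y \<noteq> {}"
        proof
          assume "X \<inter> Y = {}"
          then have "((?K - D) \<union> X) \<inter> ((?K - ?D) \<union> Y) \<inter> (?S - ?B) \<subseteq> ?K - (D \<union> ?D \<union> ?B)"
            using XY by auto
          then have "card (((?K - D) \<union> X) \<inter> ((?K - ?D) \<union> Y) \<inter> (?S - ?B)) \<le> card (?K - (D \<union> ?D \<union> ?B))"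
            by (intro card_mono) auto
          moreover have "t \<le> card (((?K - D) \<union> X) \<inter> ((?K - ?D) \<union> Y) \<inter> (?S - ?B))"
            using int XY(1) Y' B unfolding three_wise_intersecting_def by blast
          moreover have "card (?K - (D \<union> ?D \<union> ?B)) = card ?K - card (D \<union> ?D \<union> ?B)"
            using DK assms(5) by (intro card_Diff_subset) auto
          moreover have "card (D \<union> ?D \<union> ?B) = card (D \<union> ?D) + card ?B"
            using DK by (intro card_Un_disjoint) (auto dest: Dlt)
          moreover have "card (D \<union> ?D) = card D + card ?D"
            using DK by (intro card_Un_disjoint) (auto dest: Dlt)
          ultimately show False
            using DK assms(5) by simp
        qed
      qed (use p in auto)
      then have "p ^ (t + 2 * j) * pmeas p (?S - ?K) ?A \<le> p ^ (t + 2 * j) * (2 * p)"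
        using p by (intro mult_left_mono) auto
      moreover have "pmeas p ?S {G \<in> \<G>. G \<inter> ?K = ?K - D} \<le> p ^ card (?K - D) * pmeas p (?S - ?K) ?A"
        using True p by (intro pmeas_fiber_le) auto
      ultimately show ?thesis
        using cKD[OF DK(1,2)] by simp
    qed
  qed (use p finE in auto)
  finally show ?thesis
    using cE by simp
qed

section \<open>Numerical estimates\<close>

lemma real_binomial_le_pow: "real (n choose k) * fact k \<le> real n ^ k"
  by (metis binomial_fact_pow of_nat_fact of_nat_le_iff of_nat_mult of_nat_power)

text \<open>At \<open>j = 3\<close> this is 1.728 <= 1.8, and afterwards the factor
  \<open>6/5 = 4 * (3/10)\<close> is at most \<open>(j + 1) * (3/10)\<close>. The ratio 3/10 makes
  the geometric series from \<open>j = 3\<close> sum to 3/7, which is below 1/2.\<close>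

lemma power_le_fact_mult: "3 \<le> j \<Longrightarrow> (6/5) ^ j \<le> fact j * (3/10 :: real) ^ (j - 2)"
proof (induction j rule: nat_induct_at_least)
  case base
  then show ?case by (simp add: fact_numeral power3_eq_cube)
next
  case (Suc j)
  have eq: "Suc j - 2 = Suc (j - 2)"
    using Suc.hyps by simp
  have "(6/5 :: real) ^ Suc j = 6/5 * (6/5) ^ j" by simp
  also have "\<dots> \<le> 6/5 * (fact j * (3/10) ^ (j - 2))"
    using Suc.IH by simp
  also have "\<dots> = (4 * (3/10)) * (fact j * (3/10) ^ (j - 2))" by simp
  also have "\<dots> \<le> (real (Suc j) * (3/10)) * (fact j * (3/10) ^ (j - 2))"
    using Suc.hyps by (intro mult_right_mono) auto
  also have "\<dots> = fact (Suc j) * (3/10) ^ (Suc j - 2)"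
    by (simp only: eq fact_Suc power_Suc mult_ac)
  finally show ?case .
qed

text \<open>For \<open>30 * j \<le> t\<close>, \<open>t + 3 * j\<close> exceeds \<open>t\<close> by
  at most a tenth, and \<open>11/10 * (1 + p) \<le> 6/5\<close>. For larger \<open>j\<close> the
  binomial coefficient is at most 2^(33j), while \<open>p ^ (2 * j)\<close> is at most 2^(-36j); the
  constant 2^-18 comes from here.\<close>

lemma binomial_tail_term:
  assumes p: "0 < p" "p \<le> 1 / 2 ^ 18" and t: "(real t + 2) * p\<^sup>2 \<le> 1 + p" and j: "3 \<le> j"
  shows "real (t + 3 * j choose (t + 2 * j)) * p ^ (2 * j) \<le> (3/10) ^ (j - 2)"
proof -
  have sym: "(t + 3 * j choose (t + 2 * j)) = (t + 3 * j choose j)"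
    by (subst binomial_symmetric) auto
  show ?thesis
  proof (cases "30 * j \<le> t")
    case True
    have "real (t + 3 * j) * p\<^sup>2 \<le> (11/10 * (real t + 2)) * p\<^sup>2"
      using True by (intro mult_right_mono) auto
    also have "\<dots> \<le> (11/10) * (1 + p)"
      unfolding mult.assoc using t by (intro mult_left_mono) auto
    also have "\<dots> \<le> 6/5"
      using p by simp
    finally have "(real (t + 3 * j) * p\<^sup>2) ^ j \<le> (6/5) ^ j"
      using p by (intro power_mono) auto
    moreover have "real (t + 3 * j choose j) * fact j * (p\<^sup>2) ^ j \<le> real (t + 3 * j) ^ j * (p\<^sup>2) ^ j"
      using real_binomial_le_pow[of "t + 3 * j" j] by (intro mult_right_mono) auto
    ultimately have "fact j * (real (t + 3 * j choose j) * p ^ (2 * j)) \<le> (6/5) ^ j"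
      unfolding power_mult[of p 2 j] by (simp add: power_mult_distrib mult_ac)
    also have "\<dots> \<le> fact j * (3/10) ^ (j - 2)"
      using j by (rule power_le_fact_mult)
    finally show ?thesis
      unfolding sym by simp
  next
    case False
    have "real (t + 3 * j choose j) \<le> 2 ^ (t + 3 * j)"
      by (metis binomial_le_pow2 of_nat_le_iff of_nat_numeral of_nat_power)
    also have "\<dots> \<le> 2 ^ (33 * j)"
      using False by (intro power_increasing) auto
    finally have "real (t + 3 * j choose j) * p ^ (2 * j) \<le> 2 ^ (33 * j) * (1 / 2 ^ 18) ^ (2 * j)"
      using p by (intro mult_mono power_mono) auto
    also have "\<dots> = (2 ^ 33 * (1 / 2 ^ 18)\<^sup>2) ^ j"
      by (simp only: power_mult power_mult_distrib)
    also have "2 ^ 33 * (1 / 2 ^ 18)\<^sup>2 = (1/8 :: real)"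
      by (simp add: power2_eq_square)
    also have "(1/8 :: real) ^ j \<le> (3/10) ^ j"
      by (intro power_mono) auto
    also have "\<dots> \<le> (3/10) ^ (j - 2)"
      by (intro power_decreasing) auto
    finally show ?thesis
      unfolding sym .
  qed
qed

lemma sum_geometric_tail: "(\<Sum>j = 3..n. (3/10 :: real) ^ (j - 2)) \<le> 3/7"
proof (cases "n \<ge> 2")
  case True
  then have "(\<Sum>j = 3..n. (3/10 :: real) ^ (j - 2)) = 3/7 * (1 - (3/10) ^ (n - 2))"
  proof (induction n rule: nat_induct_at_least)
    case (Suc n)
    have "Suc n - 2 = Suc (n - 2)"
      using Suc.hyps by simp
    then show ?case
      using Suc by (simp only: sum.cl_ivl_Suc power_Suc) (simp add: algebra_simps)
  qed simp
  then show ?thesis by simp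
qed simp

text \<open>Relative to \<open>p ^ t\<close> the left side is at most
  \<open>((t + 6) * p\<^sup>2)\<^sup>2 / 2\<close>, hence at most 1/2 + 2p + 2p^2; the excess over
  1/2 is below 10p, which is at most \<open>\<delta>\<close>.\<close>

lemma F2_coefficient_less:
  assumes p: "0 < p" "p \<le> 1 / 2 ^ 18" "p \<le> \<delta> / 10" and t: "(real t + 2) * p\<^sup>2 \<le> 1 + p"
  shows "real (t + 6 choose (t + 4)) * p ^ (t + 4) < (1/2 + \<delta>) * p ^ t"
proof -
  have pp: "p\<^sup>2 \<le> p / 4"
    using p by (simp add: power2_eq_square mult_left_mono)
  have "real (t + 6) * p\<^sup>2 = (real t + 2) * p\<^sup>2 + 4 * p\<^sup>2"
    by (simp add: algebra_simps)
  then have "real (t + 6) * p\<^sup>2 \<le> 1 + 2 * p"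
    using t pp by simp
  then have "(real (t + 6) * p\<^sup>2)\<^sup>2 \<le> (1 + 2 * p)\<^sup>2"
    using p by (intro power_mono) auto
  also have "\<dots> = 1 + 4 * p + 4 * p\<^sup>2"
    by (simp add: power2_eq_square algebra_simps)
  finally have 1: "(real (t + 6))\<^sup>2 * p ^ 4 \<le> 1 + 4 * p + 4 * p\<^sup>2"
    by (simp add: power_mult_distrib flip: power_mult)
  have "(t + 6 choose (t + 4)) = (t + 6 choose 2)"
    by (subst binomial_symmetric) auto
  then have "2 * real (t + 6 choose (t + 4)) \<le> (real (t + 6))\<^sup>2"
    using real_binomial_le_pow[of "t + 6" 2] by (simp add: fact_numeral mult.commute)
  then have "2 * real (t + 6 choose (t + 4)) * p ^ 4 \<le> (real (t + 6))\<^sup>2 * p ^ 4"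
    by (intro mult_right_mono) auto
  then have "real (t + 6 choose (t + 4)) * p ^ 4 < 1/2 + \<delta>"
    using 1 pp p by linarith
  then have "(real (t + 6 choose (t + 4)) * p ^ 4) * p ^ t < (1/2 + \<delta>) * p ^ t"
    using p by (intro mult_strict_right_mono) auto
  then show ?thesis
    by (simp add: power_add mult_ac)
qed

text \<open>The first three groups are the bounds of \<open>pmeas_shifted_Int_F_le\<close> for
  \<open>j = 0, 1, 2\<close>, and 3/7 is the tail. As \<open>u\<close> is bounded, the three groups
  together are at most 35p relative to \<open>p ^ t\<close>, less than 1/2 - 3/7 = 1/14.\<close>

lemma F012_remainder_less:
  assumes p: "0 < p" "p \<le> 1 / 2 ^ 18" and t: "(real t + 2) * p\<^sup>2 \<le> 1 + p"
    and c: "c = real (t + 1 choose 2)"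
  shows "p ^ t * (2 * p) + (p ^ (t + 3) + 3 * p ^ (t + 2) + real t * (p ^ (t + 2) * (2 * p))) +
    (real (t + 6) * p ^ (t + 5) + (5 * real t + 15) * p ^ (t + 4) + c * (p ^ (t + 4) * (2 * p))) +
    3/7 * p ^ t < 1/2 * p ^ t"
proof -
  define u where "u = (real t + 2) * p\<^sup>2"
  have pp: "p\<^sup>2 \<le> p" "p ^ 3 \<le> p" "p \<le> 1"
    using p power_decreasing[of 1 2 p] power_decreasing[of 1 3 p] by auto
  have u: "0 \<le> u" "u \<le> 2"
    using t p pp by (auto simp: u_def)
  have "2 * c \<le> (real t + 1)\<^sup>2"
    using real_binomial_le_pow[of "t + 1" 2] by (simp add: c fact_numeral mult.commute add.commute)
  also have "\<dots> \<le> (real t + 2)\<^sup>2"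
    by (intro power_mono) auto
  finally have "2 * c * (p ^ 4 * p) \<le> (real t + 2)\<^sup>2 * (p ^ 4 * p)"
    using p by (intro mult_right_mono) auto
  also have "\<dots> = u\<^sup>2 * p"
    by (simp add: u_def power_mult_distrib flip: power_mult)
  also have "\<dots> \<le> 2\<^sup>2 * p"
    using u p by (intro mult_right_mono power_mono) auto
  finally have c': "2 * c * p ^ 4 * p \<le> 4 * p" by simp
  have "real t * p\<^sup>2 \<le> u"
    by (simp add: u_def algebra_simps)
  then have "real t * p\<^sup>2 * (2 * p) \<le> 2 * (2 * p)"
    using u p by (intro mult_right_mono) auto
  then have a1: "2 * real t * p ^ 3 \<le> 4 * p"
    by (simp add: power3_eq_cube power2_eq_square mult_ac)
  have "real (t + 6) * p\<^sup>2 = u + 4 * p\<^sup>2"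
    by (simp add: u_def algebra_simps)
  then have "real (t + 6) * p\<^sup>2 * p ^ 3 \<le> 6 * p ^ 3"
    using u p pp by (intro mult_right_mono) auto
  then have a2: "real (t + 6) * p ^ 5 \<le> 6 * p"
    using pp by (simp add: mult.assoc flip: power_add)
  have "(5 * real t + 15) * p\<^sup>2 = 5 * u + 5 * p\<^sup>2"
    by (simp add: u_def algebra_simps)
  then have "(5 * real t + 15) * p\<^sup>2 * p\<^sup>2 \<le> 15 * p\<^sup>2"
    using u p pp by (intro mult_right_mono) auto
  then have a3: "(5 * real t + 15) * p ^ 4 \<le> 15 * p"
    using pp by (simp add: mult.assoc flip: power_add)
  have "p \<le> 1 / 262144"
    using p by simp
  then have "2 * p + (p ^ 3 + 3 * p\<^sup>2 + 2 * real t * p ^ 3) +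
      (real (t + 6) * p ^ 5 + (5 * real t + 15) * p ^ 4 + 2 * c * p ^ 4 * p) + 3/7 < 1/2"
    using a1 a2 a3 c' p pp by linarith
  then have "p ^ t * (2 * p + (p ^ 3 + 3 * p\<^sup>2 + 2 * real t * p ^ 3) +
      (real (t + 6) * p ^ 5 + (5 * real t + 15) * p ^ 4 + 2 * c * p ^ 4 * p) + 3/7) < p ^ t * (1/2)"
    using p by (intro mult_strict_left_mono) auto
  then show ?thesis
    by (simp add: power_add algebra_simps power3_eq_cube power2_eq_square)
qed

text \<open>The last summand is the main one, about 1/2 relative to \<open>p ^ t\<close>. The total
  error is at most 9p/2, below \<open>\<delta>\<close>.\<close>

lemma pullback_bound_less:
  assumes p: "0 < p" "p \<le> 1 / 2 ^ 18" "p \<le> \<delta> / 10" and t: "(real t + 2) * p\<^sup>2 \<le> 1 + p"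
  shows "p ^ (t + 2) + real (t + 2) * p ^ (t + 3) + p ^ (t + 2) * (real (t + 4) / 2) < (1/2 + \<delta>) * p ^ t"
proof -
  have pp: "p\<^sup>2 \<le> p"
    using p power_decreasing[of 1 2 p] by auto
  have "real (t + 2) * p\<^sup>2 * p \<le> (1 + p) * p"
    using t p by (intro mult_right_mono) (auto simp: add.commute)
  moreover have "(1 + p) * p = p + p\<^sup>2"
    by (simp add: power2_eq_square algebra_simps)
  moreover have "real (t + 4) * p\<^sup>2 = (real t + 2) * p\<^sup>2 + 2 * p\<^sup>2"
    by (simp add: algebra_simps)
  ultimately have "p\<^sup>2 + real (t + 2) * p\<^sup>2 * p + real (t + 4) * p\<^sup>2 / 2 < 1/2 + \<delta>"
    using t p pp by linarith
  then have "p ^ t * (p\<^sup>2 + real (t + 2) * p\<^sup>2 * p + real (t + 4) * p\<^sup>2 / 2) < p ^ t * (1/2 + \<delta>)"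
    using p by (intro mult_strict_left_mono) auto
  then show ?thesis
    by (simp add: power_add algebra_simps power3_eq_cube power2_eq_square)
qed

lemma threshold_bound:
  assumes "0 < p" "p \<le> 2 / (sqrt (4 * real t + 9) - 1)"
  shows "(real t + 2) * p\<^sup>2 \<le> 1 + p" "p \<le> 1"
proof -
  let ?s = "sqrt (4 * real t + 9)"
  have "sqrt 9 \<le> ?s"
    by (intro real_sqrt_le_mono) auto
  then have s: "3 \<le> ?s" by simp
  then have "p * (?s - 1) \<le> 2"
    using assms by (simp add: pos_le_divide_eq)
  then have ps: "p * ?s \<le> 2 + p"
    by (simp add: algebra_simps)
  then have "(p * ?s)\<^sup>2 \<le> (2 + p)\<^sup>2"
    using assms s by (intro power_mono) auto
  then show "(real t + 2) * p\<^sup>2 \<le> 1 + p"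
    by (simp add: power_mult_distrib power2_eq_square algebra_simps)
  have "p * 3 \<le> p * ?s"
    using s assms by (intro mult_left_mono) auto
  then show "p \<le> 1"
    using ps by simp
qed

section \<open>Stability\<close>

lemma shifted_stability:
  assumes G: "shifted n \<G>" "up_closed {1..n} \<G>" "\<G> \<subseteq> Pow {1..n}"
    and int: "three_wise_intersecting t \<G>" and t: "0 < t" "(real t + 2) * p\<^sup>2 \<le> 1 + p"
    and p: "0 < p" "p \<le> 1 / 2 ^ 18" "p \<le> \<delta> / 10"
    and large: "(1/2 + \<delta>) * p ^ t \<le> pmeas p {1..n} \<G>"
  shows "(\<forall>G\<in>\<G>. t \<le> card (G \<inter> {1..t})) \<or> (\<forall>G\<in>\<G>. t + 2 \<le> card (G \<inter> {1..t + 3}))"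
proof (rule ccontr)
  assume "\<not> ?thesis"
  then obtain G0 G1 where G0: "G0 \<in> \<G>" "card (G0 \<inter> {1..t + 3 * 0}) < t + 2 * 0"
    and G1: "G1 \<in> \<G>" "card (G1 \<inter> {1..t + 3 * 1}) < t + 2 * 1"
    by (auto simp: not_le)
  have p': "p \<le> 1/2" "0 \<le> p" "p \<le> 1"
    using p by (auto intro: order_trans)
  let ?S = "{1..n}"
  let ?F = "\<lambda>j. {G. t + 2 * j \<le> card (G \<inter> {1..t + 3 * j})}"
  have F_le: "pmeas p ?S (?F j) \<le> real (t + 3 * j choose (t + 2 * j)) * p ^ (t + 2 * j)" for j
    using pmeas_card_Int_ge[of ?S p "{1..t + 3 * j}" "t + 2 * j"] p' by simp
  show False
  proof (cases "\<forall>G\<in>\<G>. t + 2 * 2 \<le> card (G \<inter> {1..t + 3 * 2})")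
    case True
    then have "pmeas p ?S \<G> \<le> pmeas p ?S (?F 2)"
      using p' by (intro pmeas_mono) auto
    also have "\<dots> \<le> real (t + 6 choose (t + 4)) * p ^ (t + 4)"
      using F_le[of 2] by simp
    also have "\<dots> < (1/2 + \<delta>) * p ^ t"
      using p t(2) by (rule F2_coefficient_less)
    finally show False
      using large by simp
  next
    case False
    then obtain G2 where G2: "G2 \<in> \<G>" "card (G2 \<inter> {1..t + 3 * 2}) < t + 2 * 2"
      by (auto simp: not_le)
    let ?A = "\<lambda>j. {G \<in> \<G>. t + 2 * j \<le> card (G \<inter> {1..t + 3 * j})}"
    note level = pmeas_shifted_Int_F_le[OF G int t(1) p(1) p'(1)]
    have A0: "pmeas p ?S (?A 0) \<le> p ^ t * (2 * p)"
      using level[OF G0] by (simp add: binomial_eq_0)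
    have A1: "pmeas p ?S (?A 1) \<le> p ^ (t + 3) + 3 * p ^ (t + 2) + real t * (p ^ (t + 2) * (2 * p))"
    proof -
      have eqs: "t + 3 * 1 = t + 3" "t + 2 * 1 + 1 = t + 3" "t + 2 + 1 = t + 3" "t + 2 * 1 = t + 2" "t + 1 - 1 = t"
        by auto
      have c: "(t + 3 choose (t + 3)) = 1" "real (t + 3 choose 1) - real (t choose 1) = 3"
        "real (t choose 1) = real t"
        by auto
      show ?thesis
        using level[OF G1] unfolding eqs c by simp
    qed
    have A2: "pmeas p ?S (?A 2) \<le> real (t + 6) * p ^ (t + 5) + (5 * real t + 15) * p ^ (t + 4) +
        real (t + 1 choose 2) * (p ^ (t + 4) * (2 * p))"
    proof -
      have c: "(t + 6 choose (t + 5)) = (t + 6 choose 1)"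
        by (subst binomial_symmetric) auto
      \<comment> \<open>The difference \<open>5 * t + 15\<close> counts the exceptional pairs, those
        not contained in \<open>{1..t + 1}\<close>.\<close>
      have c': "(t + 6 choose 2) = (t + 1 choose 2) + 5 * t + 15"
        by (simp add: eval_nat_numeral)
      have eqs: "t + 3 * 2 = t + 6" "t + 2 * 2 + 1 = t + 5" "t + 4 + 1 = t + 5" "t + 2 * 2 = t + 4" "t + 2 - 1 = t + 1"
        by auto
      show ?thesis
        using level[OF G2] unfolding eqs c c' by simp
    qed
    have "pmeas p ?S \<G> \<le> pmeas p ?S (?A 0 \<union> ?A 1 \<union> ?A 2 \<union> (\<Union>j\<in>{3..n}. ?F j))"
    proof (rule pmeas_mono)
      show "\<G> \<inter> Pow ?S \<subseteq> ?A 0 \<union> ?A 1 \<union> ?A 2 \<union> (\<Union>j\<in>{3..n}. ?F j)"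
      proof
        fix G assume "G \<in> \<G> \<inter> Pow ?S"
        then have GG: "G \<in> \<G>" "G \<subseteq> ?S" by auto
        obtain j where j: "t + 2 * j \<le> card (G \<inter> {1..t + 3 * j})"
          using shifted_hitting[OF G int t(1) GG(1)] by blast
        also have "\<dots> \<le> card ?S"
          using GG(2) by (intro card_mono) auto
        finally have "j \<le> n" by simp
        then consider "j = 0" | "j = 1" | "j = 2" | "j \<in> {3..n}" by fastforce
        then show "G \<in> ?A 0 \<union> ?A 1 \<union> ?A 2 \<union> (\<Union>j\<in>{3..n}. ?F j)"
          using j GG(1) by cases blast+
      qed
    qed (use p' in auto)
    also have "\<dots> \<le> pmeas p ?S (?A 0 \<union> ?A 1 \<union> ?A 2) + pmeas p ?S (\<Union>j\<in>{3..n}. ?F j)"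
      using p' by (intro pmeas_Un_le) auto
    also have "pmeas p ?S (?A 0 \<union> ?A 1 \<union> ?A 2) \<le> pmeas p ?S (?A 0 \<union> ?A 1) + pmeas p ?S (?A 2)"
      using p' by (intro pmeas_Un_le) auto
    also have "pmeas p ?S (?A 0 \<union> ?A 1) \<le> pmeas p ?S (?A 0) + pmeas p ?S (?A 1)"
      using p' by (intro pmeas_Un_le) auto
    also note A0
    also note A1
    also note A2
    also have "pmeas p ?S (\<Union>j\<in>{3..n}. ?F j) \<le> 3/7 * p ^ t"
    proof -
      have "pmeas p ?S (\<Union>j\<in>{3..n}. ?F j) \<le> (\<Sum>j = 3..n. pmeas p ?S (?F j))"
        using p' by (intro pmeas_UN_le) auto
      also have "\<dots> \<le> (\<Sum>j = 3..n. (3/10) ^ (j - 2) * p ^ t)"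
      proof (rule sum_mono)
        fix j assume j: "j \<in> {3..n}"
        have "pmeas p ?S (?F j) \<le> (real (t + 3 * j choose (t + 2 * j)) * p ^ (2 * j)) * p ^ t"
          using F_le[of j] by (simp add: power_add mult_ac)
        also have "\<dots> \<le> (3/10) ^ (j - 2) * p ^ t"
          using binomial_tail_term[OF p(1,2) t(2)] j p' by (intro mult_right_mono) auto
        finally show "pmeas p ?S (?F j) \<le> (3/10) ^ (j - 2) * p ^ t" .
      qed
      also have "\<dots> = (\<Sum>j = 3..n. (3/10) ^ (j - 2)) * p ^ t"
        by (simp add: sum_distrib_right)
      also have "\<dots> \<le> 3/7 * p ^ t"
        using sum_geometric_tail p' by (intro mult_right_mono) auto
      finally show ?thesis .
    qed
    also have "p ^ t * (2 * p) + (p ^ (t + 3) + 3 * p ^ (t + 2) + real t * (p ^ (t + 2) * (2 * p))) +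
        (real (t + 6) * p ^ (t + 5) + (5 * real t + 15) * p ^ (t + 4) +
          real (t + 1 choose 2) * (p ^ (t + 4) * (2 * p))) + 3/7 * p ^ t < 1/2 * p ^ t"
      using p(1,2) t(2) by (rule F012_remainder_less) simp
    also have "\<dots> \<le> (1/2 + \<delta>) * p ^ t"
      using p by (intro mult_right_mono) auto
    finally show False
      using large by simp
  qed
qed

text \<open>Induction on the sum of all elements of all members, which every effective shift lowers.
  The induction hypothesis gives the conclusion for the family after one shift; a pullback lemma
  transfers it back, its other alternative being excluded by the measure.\<close>

lemma up_closed_stability:
  assumes "up_closed {1..n} \<G>" "\<G> \<subseteq> Pow {1..n}"
    and "three_wise_intersecting t \<G>" and t: "0 < t" "(real t + 2) * p\<^sup>2 \<le> 1 + p"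
    and p: "0 < p" "p \<le> 1 / 2 ^ 18" "p \<le> \<delta> / 10"
    and "(1/2 + \<delta>) * p ^ t \<le> pmeas p {1..n} \<G>"
  shows "(\<exists>T \<subseteq> {1..n}. card T = t \<and> (\<forall>G\<in>\<G>. T \<subseteq> G)) \<or>
    (\<exists>T \<subseteq> {1..n}. card T = t + 3 \<and> (\<forall>G\<in>\<G>. t + 2 \<le> card (G \<inter> T)))"
  using assms(1-3,9)
proof (induction "\<Sum>H\<in>\<G>. \<Sum>H" arbitrary: \<G> rule: less_induct)
  case less
  let ?S = "{1..n}"
  have p': "p \<le> 1/2" "0 \<le> p" "p \<le> 1"
    using p by (auto intro: order_trans)
  have pos: "0 < (1/2 + \<delta>) * p ^ t"
    using p by (intro mult_pos_pos) auto
  show ?case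
  proof (cases "shifted n \<G>")
    case True
    \<comment> \<open>A member is needed to see that \<open>{1..t}\<close> fits into the ground
      set.\<close>
    have "\<G> \<noteq> {}"
      using less.prems(4) pos by (auto simp: pmeas_def)
    then obtain G where G: "G \<in> \<G>" "G \<subseteq> ?S"
      using less.prems(2) by auto
    consider "\<forall>G\<in>\<G>. t \<le> card (G \<inter> {1..t})" | "\<forall>G\<in>\<G>. t + 2 \<le> card (G \<inter> {1..t + 3})"
      using shifted_stability[OF True less.prems(1-3) t p less.prems(4)] by blast
    then show ?thesis
    proof cases
      case 1
      have "{1..t} \<subseteq> H" if "H \<in> \<G>" for H
      proof -
        have "H \<inter> {1..t} = {1..t}"
          using 1 that by (intro card_seteq) auto
        then show ?thesis by auto
      qed
      moreover from this have "{1..t} \<subseteq> ?S"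
        using G by blast
      ultimately show ?thesis
        by (intro disjI1 exI[of _ "{1..t}"]) auto
    next
      case 2
      show ?thesis
      proof (cases "t + 3 \<le> n")
        case True
        then show ?thesis
          using 2 by (intro disjI2 exI[of _ "{1..t + 3}"]) auto
      next
        case False
        \<comment> \<open>There is no room for a copy of F_1. The only possible member is then the
          whole ground set, of size \<open>t + 2\<close>, which a copy of F_0 contains.\<close>
        have all: "H = ?S" "t + 2 \<le> n" if "H \<in> \<G>" for H
        proof -
          have H: "H \<subseteq> ?S"
            using that less.prems(2) by auto
          then have "card (H \<inter> {1..t + 3}) \<le> card H" "card H \<le> n"
            using finite_subset[OF H] card_mono[OF _ H] by (auto intro: card_mono)
          moreover have "t + 2 \<le> card (H \<inter> {1..t + 3})"
            using 2 that by blast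
          ultimately have "t + 2 \<le> card H" and n: "t + 2 \<le> n"
            by linarith+
          then show "H = ?S"
            using H False by (intro card_seteq) auto
          show "t + 2 \<le> n" by (fact n)
        qed
        then have "{1..t} \<subseteq> ?S"
          using all(2)[OF G(1)] by auto
        moreover from this have "\<forall>H\<in>\<G>. {1..t} \<subseteq> H"
          using all(1) by blast
        ultimately show ?thesis
          by (intro disjI1 exI[of _ "{1..t}"]) auto
      qed
    qed
  next
    case False
    then obtain i j where ij: "i \<in> ?S" "j \<in> ?S" "i < j" "shift i j \<G> \<noteq> \<G>"
      unfolding shifted_def by blast
    note sub = less.prems(2)
    have meas: "pmeas p ?S (shift i j \<G>) = pmeas p ?S \<G>"
      using ij sub by (intro pmeas_shift) auto
    consider T where "T \<subseteq> ?S" "card T = t" "\<And>H. H \<in> shift i j \<G> \<Longrightarrow> T \<subseteq> H"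
      | T where "T \<subseteq> ?S" "card T = t + 3" "\<And>H. H \<in> shift i j \<G> \<Longrightarrow> t + 2 \<le> card (H \<inter> T)"
    proof -
      have "(\<Sum>H\<in>shift i j \<G>. \<Sum>H) < (\<Sum>H\<in>\<G>. \<Sum>H)"
        using ij sub by (intro sum_shift_less[of ?S]) auto
      moreover have "up_closed ?S (shift i j \<G>)"
        using less.prems(1) ij by (intro up_closed_shift) auto
      moreover have "shift i j \<G> \<subseteq> Pow ?S"
        using ij sub by (intro shift_subset_Pow) auto
      moreover have "three_wise_intersecting t (shift i j \<G>)"
        using less.prems(3) sub by (intro three_wise_shift[of t \<G> ?S]) auto
      ultimately show ?thesis
        using less.hyps[of "shift i j \<G>"] less.prems(4) meas that by (metis (no_types, lifting))
    qed
    then show ?thesis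
    proof cases
      case 1
      have "(\<exists>T \<subseteq> ?S. card T = t \<and> (\<forall>G\<in>\<G>. T \<subseteq> G)) \<or> pmeas p ?S \<G> \<le> 5 * p * p ^ t"
        by (rule pullback_shift_F0[OF _ ij(1,2) sub p(1) p'(1) less.prems(3) 1]) simp
      moreover have "5 * p * p ^ t < (1/2 + \<delta>) * p ^ t"
        using p by (intro mult_strict_right_mono) auto
      then have "\<not> pmeas p ?S \<G> \<le> 5 * p * p ^ t"
        using less.prems(4) by linarith
      ultimately show ?thesis by blast
    next
      case 2
      let ?b = "p ^ (t + 2) + real (t + 2) * p ^ (t + 3) + p ^ (t + 2) * (real (t + 4) / 2)"
      have "(\<exists>T \<subseteq> ?S. card T = t + 3 \<and> (\<forall>G\<in>\<G>. t + 2 \<le> card (G \<inter> T))) \<or> pmeas p ?S \<G> \<le> ?b"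
        by (rule pullback_shift_F1[OF _ ij(1,2) sub p(1) p'(1) less.prems(3,1) 2]) simp
      moreover have "\<not> pmeas p ?S \<G> \<le> ?b"
        using less.prems(4) pullback_bound_less[OF p t(2)] by linarith
      ultimately show ?thesis by blast
    qed
  qed
qed

section \<open>Copies of \<open>frankl_family\<close> on an arbitrary set of the right size\<close>

lemma ex_permutes_image_eq:
  assumes "finite S" "T \<subseteq> S" "T' \<subseteq> S" "card T = card T'"
  shows "\<exists>\<tau>. \<tau> permutes S \<and> \<tau> ` T = T'"
proof -
  have fin: "finite T" "finite T'"
    using assms finite_subset by blast+
  obtain f where f: "bij_betw f T T'"
    using finite_same_card_bij[OF fin assms(4)] by blast
  have "card (S - T) = card (S - T')"
    using assms fin by (simp add: card_Diff_subset)
  then obtain g where g: "bij_betw g (S - T) (S - T')"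
    using finite_same_card_bij[of "S - T" "S - T'"] assms(1) by blast
  define \<tau> where "\<tau> x = (if x \<in> T then f x else if x \<in> S then g x else x)" for x
  have f': "bij_betw \<tau> T T'"
    using f by (rule bij_betw_cong[THEN iffD1, rotated]) (simp add: \<tau>_def)
  have "bij_betw \<tau> (S - T) (S - T')"
    using g by (rule bij_betw_cong[THEN iffD1, rotated]) (simp add: \<tau>_def)
  then have "bij_betw \<tau> (T \<union> (S - T)) (T' \<union> (S - T'))"
    using f' by (intro bij_betw_combine) auto
  then have "bij_betw \<tau> S S"
    using assms by (simp add: Un_absorb1)
  then have "\<tau> permutes S"
    using assms(2) by (intro bij_imp_permutes) (auto simp: \<tau>_def)
  then show ?thesis
    using bij_betw_imp_surj_on[OF f'] by blast
qed

lemma isomorphic_frankl_family: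
  assumes "T \<subseteq> {1..n}" "card T = t + 3 * i"
  shows "isomorphic_families n {F. F \<subseteq> {1..n} \<and> t + 2 * i \<le> card (F \<inter> T)} (frankl_family n t i)"
proof -
  have "t + 3 * i \<le> n"
    using card_mono[OF _ assms(1)] assms(2) by simp
  then obtain \<tau> where \<tau>: "\<tau> permutes {1..n}" "\<tau> ` T = {1..t + 3 * i}"
    using ex_permutes_image_eq[of "{1..n}" T "{1..t + 3 * i}"] assms by auto
  have card_eq: "card (\<tau> ` F \<inter> {1..t + 3 * i}) = card (F \<inter> T)" for F
    using \<tau> permutes_inj[OF \<tau>(1)] by (metis card_image image_Int inj_on_subset subset_UNIV)
  have "frankl_family n t i = (\<lambda>G. \<tau> ` G) ` {F. F \<subseteq> {1..n} \<and> t + 2 * i \<le> card (F \<inter> T)}" (is "_ = ?R")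
  proof
    show "frankl_family n t i \<subseteq> ?R"
    proof
      fix F assume F: "F \<in> frankl_family n t i"
      have eq: "F = \<tau> ` (inv \<tau> ` F)"
        using permutes_surj[OF \<tau>(1)] by (simp add: image_f_inv_f)
      have "inv \<tau> ` F \<subseteq> inv \<tau> ` {1..n}"
        using F by (intro image_mono) (auto simp: frankl_family_def)
      then have "inv \<tau> ` F \<subseteq> {1..n}"
        using permutes_image[OF permutes_inv[OF \<tau>(1)]] by simp
      moreover have "t + 2 * i \<le> card (inv \<tau> ` F \<inter> T)"
        using F card_eq[of "inv \<tau> ` F"] eq by (auto simp: frankl_family_def)
      ultimately show "F \<in> ?R"
        using eq by blast
    qed
    show "?R \<subseteq> frankl_family n t i"
      using permutes_image[OF \<tau>(1)] by (auto simp: frankl_family_def card_eq[simplified])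
  qed
  then show ?thesis
    using \<tau>(1) by (auto simp: isomorphic_families_def)
qed

theorem theorem5:
  shows "\<forall>\<delta>::real. \<delta> > 0 \<longrightarrow>
    (\<exists>t0::nat. \<forall>(t::nat) (p::real) (n::nat) (\<G>::nat set set).
       t > 0 \<longrightarrow> t > t0 \<longrightarrow> 0 < p \<longrightarrow> p \<le> 2 / (sqrt (4 * real t + 9) - 1) \<longrightarrow> n > 0 \<longrightarrow>
       \<G> \<subseteq> Pow {1..n} \<longrightarrow> three_wise_intersecting t \<G> \<longrightarrow>
       biased_measure n p \<G> \<ge> (1 / 2 + \<delta>) * p ^ t \<longrightarrow>
       (\<exists>\<F>. \<F> \<subseteq> Pow {1..n} \<and> \<G> \<subseteq> \<F> \<and>
          (t \<le> n \<and> isomorphic_families n \<F> (frankl_family n t 0) \<or>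
           t + 3 \<le> n \<and> isomorphic_families n \<F> (frankl_family n t 1))))"
proof (intro allI impI)
  fix \<delta> :: real assume \<delta>: "\<delta> > 0"
  define q where "q = min (1 / 2 ^ 18) (\<delta> / 10)"
  have q: "0 < q"
    using \<delta> by (simp add: q_def)
  show "\<exists>t0::nat. \<forall>(t::nat) (p::real) (n::nat) (\<G>::nat set set).
       t > 0 \<longrightarrow> t > t0 \<longrightarrow> 0 < p \<longrightarrow> p \<le> 2 / (sqrt (4 * real t + 9) - 1) \<longrightarrow> n > 0 \<longrightarrow>
       \<G> \<subseteq> Pow {1..n} \<longrightarrow> three_wise_intersecting t \<G> \<longrightarrow>
       biased_measure n p \<G> \<ge> (1 / 2 + \<delta>) * p ^ t \<longrightarrow>
       (\<exists>\<F>. \<F> \<subseteq> Pow {1..n} \<and> \<G> \<subseteq> \<F> \<and>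
          (t \<le> n \<and> isomorphic_families n \<F> (frankl_family n t 0) \<or>
           t + 3 \<le> n \<and> isomorphic_families n \<F> (frankl_family n t 1)))"
  \<comment> \<open>With this threshold, \<open>p > q\<close> would give (t + 2) p^2 > t q^2 >= 2 >=
    1 + p, against the bound on \<open>p\<close>.\<close>
  proof (intro exI[of _ "nat \<lceil>2 / q\<^sup>2\<rceil>"] allI impI)
    fix t n :: nat and p :: real and \<G> :: "nat set set"
    assume t: "t > 0" "t > nat \<lceil>2 / q\<^sup>2\<rceil>" and p: "0 < p" "p \<le> 2 / (sqrt (4 * real t + 9) - 1)"
      and sub: "\<G> \<subseteq> Pow {1..n}" and int: "three_wise_intersecting t \<G>"
      and large: "biased_measure n p \<G> \<ge> (1 / 2 + \<delta>) * p ^ t"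
    let ?S = "{1..n}"
    note bound = threshold_bound[OF p]
    have "2 / q\<^sup>2 \<le> real t"
      using t(2) by linarith
    then have tq: "2 \<le> real t * q\<^sup>2"
      using q by (simp add: field_simps)
    have pq: "p \<le> q"
    proof (rule ccontr)
      assume "\<not> p \<le> q"
      then have "q\<^sup>2 \<le> p\<^sup>2"
        using q by (intro power_mono) auto
      then have "real t * q\<^sup>2 \<le> real t * p\<^sup>2"
        by (intro mult_left_mono) auto
      moreover have "0 < p\<^sup>2"
        using p by simp
      moreover have "(real t + 2) * p\<^sup>2 = real t * p\<^sup>2 + 2 * p\<^sup>2"
        by (simp add: algebra_simps)
      ultimately show False
        using tq bound by linarith
    qed
    define \<U> where "\<U> = {H \<in> Pow ?S. \<exists>G\<in>\<G>. G \<subseteq> H}"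
    have sub_\<U>: "\<G> \<subseteq> \<U>" "\<U> \<subseteq> Pow ?S"
      using sub by (auto simp: \<U>_def)
    have up: "up_closed ?S \<U>"
      by (auto simp: up_closed_def \<U>_def)
    have int_\<U>: "three_wise_intersecting t \<U>"
      unfolding three_wise_intersecting_def
    proof (intro ballI)
      fix H1 H2 H3 assume H: "H1 \<in> \<U>" "H2 \<in> \<U>" "H3 \<in> \<U>"
      then obtain G1 G2 G3 where G: "G1 \<in> \<G>" "G2 \<in> \<G>" "G3 \<in> \<G>" "G1 \<subseteq> H1" "G2 \<subseteq> H2" "G3 \<subseteq> H3"
        by (auto simp: \<U>_def)
      have "finite (H1 \<inter> H2 \<inter> H3)"
        using H by (auto simp: \<U>_def intro: finite_subset)
      then have "card (G1 \<inter> G2 \<inter> G3) \<le> card (H1 \<inter> H2 \<inter> H3)"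
        using G by (intro card_mono) auto
      moreover have "t \<le> card (G1 \<inter> G2 \<inter> G3)"
        using int G unfolding three_wise_intersecting_def by blast
      ultimately show "t \<le> card (H1 \<inter> H2 \<inter> H3)" by simp
    qed
    have "biased_measure n p \<G> = pmeas p ?S \<G>"
      unfolding biased_measure_def pmeas_def
    proof (rule sum.cong)
      fix G assume "G \<in> \<G> \<inter> Pow ?S"
      then have "card (?S - G) = n - card G"
        by (subst card_Diff_subset) (auto intro: finite_subset)
      then show "p ^ card G * (1 - p) ^ (n - card G) = p ^ card G * (1 - p) ^ card (?S - G)" by simp
    qed (use sub in auto)
    also have "\<dots> \<le> pmeas p ?S \<U>"
      using sub_\<U> p bound by (intro pmeas_mono) auto
    finally have "(1/2 + \<delta>) * p ^ t \<le> pmeas p ?S \<U>"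
      using large by simp
    moreover have "p \<le> 1 / 2 ^ 18" "p \<le> \<delta> / 10"
      using pq by (auto simp: q_def)
    ultimately have "(\<exists>T \<subseteq> ?S. card T = t \<and> (\<forall>G\<in>\<U>. T \<subseteq> G)) \<or>
        (\<exists>T \<subseteq> ?S. card T = t + 3 \<and> (\<forall>G\<in>\<U>. t + 2 \<le> card (G \<inter> T)))"
      by (intro up_closed_stability[OF up sub_\<U>(2) int_\<U> t(1) bound(1) p(1)])
    then consider T where "T \<subseteq> ?S" "card T = t" "\<forall>G\<in>\<U>. T \<subseteq> G"
      | T where "T \<subseteq> ?S" "card T = t + 3" "\<forall>G\<in>\<U>. t + 2 \<le> card (G \<inter> T)"
      by blast
    then show "\<exists>\<F>. \<F> \<subseteq> Pow ?S \<and> \<G> \<subseteq> \<F> \<and>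
          (t \<le> n \<and> isomorphic_families n \<F> (frankl_family n t 0) \<or>
           t + 3 \<le> n \<and> isomorphic_families n \<F> (frankl_family n t 1))"
    proof cases
      case (1 T)
      \<comment> \<open>As \<open>T\<close> has exactly \<open>t\<close> elements, the cardinality
        condition means \<open>T \<subseteq> F\<close>.\<close>
      let ?F = "{F. F \<subseteq> ?S \<and> t + 2 * 0 \<le> card (F \<inter> T)}"
      have "t \<le> card (G \<inter> T)" if "G \<in> \<U>" for G
        using 1 that by (simp add: Int_absorb1)
      then have "\<G> \<subseteq> ?F"
        using sub_\<U> by auto
      moreover have "isomorphic_families n ?F (frankl_family n t 0)"
        using 1 by (intro isomorphic_frankl_family) auto
      moreover have "t \<le> n"
        using card_mono[OF _ 1(1)] 1(2) by simp
      moreover have "?F \<subseteq> Pow ?S"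
        by auto
      ultimately show ?thesis
        by (intro exI[of _ ?F] conjI disjI1)
    next
      case (2 T)
      let ?F = "{F. F \<subseteq> ?S \<and> t + 2 * 1 \<le> card (F \<inter> T)}"
      have "\<G> \<subseteq> ?F"
        using sub_\<U> 2(3) by auto
      moreover have "isomorphic_families n ?F (frankl_family n t 1)"
        using 2 by (intro isomorphic_frankl_family) auto
      moreover have "t + 3 \<le> n"
        using card_mono[OF _ 2(1)] 2(2) by simp
      moreover have "?F \<subseteq> Pow ?S"
        by auto
      ultimately show ?thesis
        by (intro exI[of _ ?F] conjI disjI2)
    qed
  qed
qed

end
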